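(* Let $A$ and $B$ be unital associative algebras over a field $k$, and let $\psi: B\otimes A\to A\otimes B$ be a twist map satisfying the associativity condition and such that $(A\otimes B,m_\psi)$ has a unit map $\eta_\psi: k\to A\otimes B$, $\eta_\psi(1)=z_A\otimes z_B$ (a possible sum being understood); write $A\otimes_\psi B=(A\otimes B,m_\psi,\eta_\psi)$. Let $i_A: A\to A\otimes_\psi B$, $i_A(a)=a z_A\otimes z_B$, and $i_B: B\to A\otimes_\psi B$, $i_B(b)=z_A\otimes z_B b$. Let $X$ be an associative (unital) algebra together with algebra morphisms $j_A: A\to X$, $j_B: B\to X$ such that $$m_X\circ(j_B\otimes j_A)=m_X\circ(j_A\otimes j_B)\circ\psi,\qquad m_X\circ(j_A\otimes j_B)\circ\eta_\psi=\eta_X .$$ Then there exists an algebra morphism $\omega: A\otimes_\psi B\to X$ such that $j_A=\omega\circ i_A$ and $j_B=\omega\circ i_B$.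
   Context: For a unital algebra $A$, $m_A$ and $\eta_A$ denote multiplication and unit map; algebra morphisms are unital. A twist map is a $k$-linear map $\psi: B\otimes A\to A\otimes B$. The twisted product on $A\otimes B$ is $m_\psi:=(m_A\otimes m_B)(\mathrm{id}_A\otimes\psi\otimes\mathrm{id}_B):(A\otimes B)\otimes(A\otimes B)\to A\otimes B$. The associativity condition on $\psi$ (equivalent to associativity of $m_\psi$) is $$(\mathrm{id}_A\otimes m_B)(\psi\otimes\mathrm{id}_B)(\mathrm{id}_B\otimes m_A\otimes\mathrm{id}_B)(\mathrm{id}_B\otimes\mathrm{id}_A\otimes\psi)=(m_A\otimes\mathrm{id}_B)(\mathrm{id}_A\otimes\psi)(\mathrm{id}_A\otimes m_B\otimes\mathrm{id}_A)(\psi\otimes\mathrm{id}_B\otimes\mathrm{id}_A).$$ *)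

theory Defs
  imports "HOL-Algebra.Module" "HOL-Algebra.AbelCoset"
begin

section \<open>Algebras and linear maps\<close>

text \<open>Unlike the library's \<open>algebra\<close>, the multiplication need not be commutative.\<close>

locale unital_algebra = module K A + ring A for K (structure) and A (structure) +
  assumes smult_mult_left:
      "\<lbrakk>c \<in> carrier K; x \<in> carrier A; y \<in> carrier A\<rbrakk>
        \<Longrightarrow> (c \<odot>\<^bsub>A\<^esub> x) \<otimes>\<^bsub>A\<^esub> y = c \<odot>\<^bsub>A\<^esub> (x \<otimes>\<^bsub>A\<^esub> y)"
    and smult_mult_right:
      "\<lbrakk>c \<in> carrier K; x \<in> carrier A; y \<in> carrier A\<rbrakk>
        \<Longrightarrow> x \<otimes>\<^bsub>A\<^esub> (c \<odot>\<^bsub>A\<^esub> y) = c \<odot>\<^bsub>A\<^esub> (x \<otimes>\<^bsub>A\<^esub> y)"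

definition linear_maps ::
    "('k, 'r) ring_scheme \<Rightarrow> ('k, 'a, 'm) module_scheme \<Rightarrow> ('k, 'b, 'n) module_scheme \<Rightarrow> ('a \<Rightarrow> 'b) set"
  where "linear_maps K M N =
    {f \<in> carrier M \<rightarrow> carrier N.
      (\<forall>x\<in>carrier M. \<forall>y\<in>carrier M. f (x \<oplus>\<^bsub>M\<^esub> y) = f x \<oplus>\<^bsub>N\<^esub> f y) \<and>
      (\<forall>c\<in>carrier K. \<forall>x\<in>carrier M. f (c \<odot>\<^bsub>M\<^esub> x) = c \<odot>\<^bsub>N\<^esub> f x)}"

definition algebra_homs ::
    "('k, 'r) ring_scheme \<Rightarrow> ('k, 'a, 'm) module_scheme \<Rightarrow> ('k, 'b, 'n) module_scheme \<Rightarrow> ('a \<Rightarrow> 'b) set"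
  where "algebra_homs K A B = ring_hom A B \<inter> linear_maps K A B"

definition self_module :: "('k, 'r) ring_scheme \<Rightarrow> ('k, 'k) module"
  where "self_module K =
    \<lparr>carrier = carrier K, mult = mult K, one = \<one>\<^bsub>K\<^esub>, zero = \<zero>\<^bsub>K\<^esub>, add = add K, smult = mult K\<rparr>"


section \<open>Tensor products\<close>

text \<open>The tensor product of \<open>M\<close> and \<open>N\<close> is the quotient of the free module on
  \<open>carrier M \<times> carrier N\<close> (finitely supported functions) by the bilinearity relations.
  The ring fields \<open>mult\<close> and \<open>one\<close> of the records below carry no meaning.\<close>

definition free_module :: "('k, 'r) ring_scheme \<Rightarrow> 's set \<Rightarrow> ('k, 's \<Rightarrow> 'k) module"
  where "free_module K S =
    \<lparr>carrier = {f. range f \<subseteq> carrier K \<and> {s. f s \<noteq> \<zero>\<^bsub>K\<^esub>} \<subseteq> S \<and> finite {s. f s \<noteq> \<zero>\<^bsub>K\<^esub>}},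
     mult = undefined, one = undefined,
     zero = (\<lambda>s. \<zero>\<^bsub>K\<^esub>),
     add = (\<lambda>f g s. f s \<oplus>\<^bsub>K\<^esub> g s),
     smult = (\<lambda>c f s. c \<otimes>\<^bsub>K\<^esub> f s)\<rparr>"

definition free_gen :: "('k, 'r) ring_scheme \<Rightarrow> 's \<Rightarrow> 's \<Rightarrow> 'k"
  where "free_gen K s = (\<lambda>t. if t = s then \<one>\<^bsub>K\<^esub> else \<zero>\<^bsub>K\<^esub>)"

definition submodule_span ::
    "('k, 'r) ring_scheme \<Rightarrow> ('k, 'a, 'm) module_scheme \<Rightarrow> 'a set \<Rightarrow> 'a set"
  where "submodule_span K M S = \<Inter>{H. submodule H K M \<and> S \<subseteq> H}"

definition quot_module :: "('k, 'a, 'm) module_scheme \<Rightarrow> 'a set \<Rightarrow> ('k, 'a set) module"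
  where "quot_module M H =
    \<lparr>carrier = a_rcosets\<^bsub>M\<^esub> H,
     mult = undefined, one = undefined,
     zero = H,
     add = (\<lambda>X Y. X <+>\<^bsub>M\<^esub> Y),
     smult = (\<lambda>c X. \<Union>x\<in>X. H +>\<^bsub>M\<^esub> (c \<odot>\<^bsub>M\<^esub> x))\<rparr>"

definition bilinear_relations ::
    "('k, 'r) ring_scheme \<Rightarrow> ('k, 'a, 'm) module_scheme \<Rightarrow> ('k, 'b, 'n) module_scheme
      \<Rightarrow> ('a \<times> 'b \<Rightarrow> 'k) set"
  where "bilinear_relations K M N =
    (let F = free_module K (carrier M \<times> carrier N); \<delta> = (\<lambda>x y. free_gen K (x, y)) in
      {\<delta> (x \<oplus>\<^bsub>M\<^esub> x') y \<ominus>\<^bsub>F\<^esub> (\<delta> x y \<oplus>\<^bsub>F\<^esub> \<delta> x' y) | x x' y.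
         x \<in> carrier M \<and> x' \<in> carrier M \<and> y \<in> carrier N} \<union>
      {\<delta> x (y \<oplus>\<^bsub>N\<^esub> y') \<ominus>\<^bsub>F\<^esub> (\<delta> x y \<oplus>\<^bsub>F\<^esub> \<delta> x y') | x y y'.
         x \<in> carrier M \<and> y \<in> carrier N \<and> y' \<in> carrier N} \<union>
      {\<delta> (c \<odot>\<^bsub>M\<^esub> x) y \<ominus>\<^bsub>F\<^esub> (c \<odot>\<^bsub>F\<^esub> \<delta> x y) | c x y.
         c \<in> carrier K \<and> x \<in> carrier M \<and> y \<in> carrier N} \<union>
      {\<delta> x (c \<odot>\<^bsub>N\<^esub> y) \<ominus>\<^bsub>F\<^esub> (c \<odot>\<^bsub>F\<^esub> \<delta> x y) | c x y.
         c \<in> carrier K \<and> x \<in> carrier M \<and> y \<in> carrier N})"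

definition tensor_null ::
    "('k, 'r) ring_scheme \<Rightarrow> ('k, 'a, 'm) module_scheme \<Rightarrow> ('k, 'b, 'n) module_scheme
      \<Rightarrow> ('a \<times> 'b \<Rightarrow> 'k) set"
  where "tensor_null K M N =
    submodule_span K (free_module K (carrier M \<times> carrier N)) (bilinear_relations K M N)"

definition tensor ::
    "('k, 'r) ring_scheme \<Rightarrow> ('k, 'a, 'm) module_scheme \<Rightarrow> ('k, 'b, 'n) module_scheme
      \<Rightarrow> ('k, ('a \<times> 'b \<Rightarrow> 'k) set) module"  (infixr \<open>\<boxtimes>\<index>\<close> 70)
  where "M \<boxtimes>\<^bsub>K\<^esub> N = quot_module (free_module K (carrier M \<times> carrier N)) (tensor_null K M N)"

definition pure_tensor ::
    "('k, 'r) ring_scheme \<Rightarrow> ('k, 'a, 'm) module_scheme \<Rightarrow> ('k, 'b, 'n) module_scheme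
      \<Rightarrow> 'a \<Rightarrow> 'b \<Rightarrow> ('a \<times> 'b \<Rightarrow> 'k) set"
  where "pure_tensor K M N x y =
    tensor_null K M N +>\<^bsub>free_module K (carrier M \<times> carrier N)\<^esub> free_gen K (x, y)"

text \<open>The linear map into \<open>P\<close> that a \<open>K\<close>-bilinear map \<open>f\<close> induces on a tensor product: the class
  of a formal combination \<open>h\<close> goes to \<open>\<Sum> h(x, y) f(x, y)\<close>, which is the same for all
  representatives \<open>h\<close> of the class if \<open>f\<close> is bilinear.\<close>

definition tensor_lift ::
    "('k, 'r) ring_scheme \<Rightarrow> ('k, 'c, 'p) module_scheme \<Rightarrow> ('a \<Rightarrow> 'b \<Rightarrow> 'c)
      \<Rightarrow> ('a \<times> 'b \<Rightarrow> 'k) set \<Rightarrow> 'c"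
  where "tensor_lift K P f t =
    the_elem ((\<lambda>h. \<Oplus>\<^bsub>P\<^esub>s\<in>{s. h s \<noteq> \<zero>\<^bsub>K\<^esub>}. h s \<odot>\<^bsub>P\<^esub> f (fst s) (snd s)) ` t)"

text \<open>\<open>tensor_map K M' N' f g\<close> is \<open>f \<otimes> g\<close>, where \<open>M'\<close> and \<open>N'\<close> are the codomains of
  \<open>f\<close> and \<open>g\<close>.\<close>

definition tensor_map ::
    "('k, 'r) ring_scheme \<Rightarrow> ('k, 'c, 'm) module_scheme \<Rightarrow> ('k, 'd, 'n) module_scheme
      \<Rightarrow> ('a \<Rightarrow> 'c) \<Rightarrow> ('b \<Rightarrow> 'd) \<Rightarrow> ('a \<times> 'b \<Rightarrow> 'k) set \<Rightarrow> ('c \<times> 'd \<Rightarrow> 'k) set"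
  where "tensor_map K M' N' f g =
    tensor_lift K (M' \<boxtimes>\<^bsub>K\<^esub> N') (\<lambda>x y. pure_tensor K M' N' (f x) (g y))"

text \<open>The canonical isomorphisms \<open>(M \<otimes> N) \<otimes> P \<rightarrow> M \<otimes> (N \<otimes> P)\<close> and
  \<open>M \<otimes> (N \<otimes> P) \<rightarrow> (M \<otimes> N) \<otimes> P\<close>.\<close>

definition reassoc_right ::
    "('k, 'r) ring_scheme \<Rightarrow> ('k, 'a, 'm) module_scheme \<Rightarrow> ('k, 'b, 'n) module_scheme
      \<Rightarrow> ('k, 'c, 'p) module_scheme
      \<Rightarrow> (('a \<times> 'b \<Rightarrow> 'k) set \<times> 'c \<Rightarrow> 'k) set \<Rightarrow> ('a \<times> ('b \<times> 'c \<Rightarrow> 'k) set \<Rightarrow> 'k) set"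
  where "reassoc_right K M N P =
    tensor_lift K (M \<boxtimes>\<^bsub>K\<^esub> (N \<boxtimes>\<^bsub>K\<^esub> P))
      (\<lambda>t z. tensor_lift K (M \<boxtimes>\<^bsub>K\<^esub> (N \<boxtimes>\<^bsub>K\<^esub> P))
        (\<lambda>x y. pure_tensor K M (N \<boxtimes>\<^bsub>K\<^esub> P) x (pure_tensor K N P y z)) t)"

definition reassoc_left ::
    "('k, 'r) ring_scheme \<Rightarrow> ('k, 'a, 'm) module_scheme \<Rightarrow> ('k, 'b, 'n) module_scheme
      \<Rightarrow> ('k, 'c, 'p) module_scheme
      \<Rightarrow> ('a \<times> ('b \<times> 'c \<Rightarrow> 'k) set \<Rightarrow> 'k) set \<Rightarrow> (('a \<times> 'b \<Rightarrow> 'k) set \<times> 'c \<Rightarrow> 'k) set"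
  where "reassoc_left K M N P =
    tensor_lift K ((M \<boxtimes>\<^bsub>K\<^esub> N) \<boxtimes>\<^bsub>K\<^esub> P)
      (\<lambda>x t. tensor_lift K ((M \<boxtimes>\<^bsub>K\<^esub> N) \<boxtimes>\<^bsub>K\<^esub> P)
        (\<lambda>y z. pure_tensor K (M \<boxtimes>\<^bsub>K\<^esub> N) P (pure_tensor K M N x y) z) t)"


section \<open>Twisted tensor products\<close>

definition mult_map ::
    "('k, 'r) ring_scheme \<Rightarrow> ('k, 'a, 'm) module_scheme \<Rightarrow> ('a \<times> 'a \<Rightarrow> 'k) set \<Rightarrow> 'a"
  where "mult_map K A = tensor_lift K A (\<lambda>x y. x \<otimes>\<^bsub>A\<^esub> y)"

definition unit_map :: "('k, 'a, 'm) module_scheme \<Rightarrow> 'k \<Rightarrow> 'a"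
  where "unit_map A c = c \<odot>\<^bsub>A\<^esub> \<one>\<^bsub>A\<^esub>"

text \<open>\<open>m\<^sub>\<psi> = (m\<^sub>A \<otimes> m\<^sub>B) (id\<^sub>A \<otimes> \<psi> \<otimes> id\<^sub>B)\<close>, with the implicit rebracketings inserted.\<close>

definition twisted_mult ::
    "('k, 'r) ring_scheme \<Rightarrow> ('k, 'a, 'm) module_scheme \<Rightarrow> ('k, 'b, 'n) module_scheme
      \<Rightarrow> (('b \<times> 'a \<Rightarrow> 'k) set \<Rightarrow> ('a \<times> 'b \<Rightarrow> 'k) set)
      \<Rightarrow> (('a \<times> 'b \<Rightarrow> 'k) set \<times> ('a \<times> 'b \<Rightarrow> 'k) set \<Rightarrow> 'k) set \<Rightarrow> ('a \<times> 'b \<Rightarrow> 'k) set"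
  where "twisted_mult K A B \<psi> =
    tensor_map K A B (mult_map K A) (mult_map K B)
    \<circ> reassoc_left K A A (B \<boxtimes>\<^bsub>K\<^esub> B)
    \<circ> tensor_map K A (A \<boxtimes>\<^bsub>K\<^esub> (B \<boxtimes>\<^bsub>K\<^esub> B)) id (reassoc_right K A B B)
    \<circ> tensor_map K A ((A \<boxtimes>\<^bsub>K\<^esub> B) \<boxtimes>\<^bsub>K\<^esub> B) id (tensor_map K (A \<boxtimes>\<^bsub>K\<^esub> B) B \<psi> id)
    \<circ> tensor_map K A ((B \<boxtimes>\<^bsub>K\<^esub> A) \<boxtimes>\<^bsub>K\<^esub> B) id (reassoc_left K B A B)
    \<circ> reassoc_right K A B (A \<boxtimes>\<^bsub>K\<^esub> B)"

text \<open>The associativity condition on \<open>\<psi>\<close>, as an equality of maps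
  \<open>B \<otimes> (A \<otimes> (B \<otimes> A)) \<rightarrow> A \<otimes> B\<close>, again with the rebracketings inserted.\<close>

definition twist_associative ::
    "('k, 'r) ring_scheme \<Rightarrow> ('k, 'a, 'm) module_scheme \<Rightarrow> ('k, 'b, 'n) module_scheme
      \<Rightarrow> (('b \<times> 'a \<Rightarrow> 'k) set \<Rightarrow> ('a \<times> 'b \<Rightarrow> 'k) set) \<Rightarrow> bool"
  where "twist_associative K A B \<psi> \<longleftrightarrow>
    (\<forall>t\<in>carrier (B \<boxtimes>\<^bsub>K\<^esub> (A \<boxtimes>\<^bsub>K\<^esub> (B \<boxtimes>\<^bsub>K\<^esub> A))).
      (tensor_map K A B id (mult_map K B)
       \<circ> reassoc_right K A B B
       \<circ> tensor_map K (A \<boxtimes>\<^bsub>K\<^esub> B) B \<psi> id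
       \<circ> reassoc_left K B A B
       \<circ> tensor_map K B (A \<boxtimes>\<^bsub>K\<^esub> B) id (tensor_map K A B (mult_map K A) id)
       \<circ> tensor_map K B ((A \<boxtimes>\<^bsub>K\<^esub> A) \<boxtimes>\<^bsub>K\<^esub> B) id (reassoc_left K A A B)
       \<circ> tensor_map K B (A \<boxtimes>\<^bsub>K\<^esub> (A \<boxtimes>\<^bsub>K\<^esub> B)) id (tensor_map K A (A \<boxtimes>\<^bsub>K\<^esub> B) id \<psi>)) t
      = (tensor_map K A B (mult_map K A) id
         \<circ> reassoc_left K A A B
         \<circ> tensor_map K A (A \<boxtimes>\<^bsub>K\<^esub> B) id \<psi>
         \<circ> tensor_map K A (B \<boxtimes>\<^bsub>K\<^esub> A) id (tensor_map K B A (mult_map K B) id)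
         \<circ> tensor_map K A ((B \<boxtimes>\<^bsub>K\<^esub> B) \<boxtimes>\<^bsub>K\<^esub> A) id (reassoc_left K B B A)
         \<circ> reassoc_right K A B (B \<boxtimes>\<^bsub>K\<^esub> A)
         \<circ> tensor_map K (A \<boxtimes>\<^bsub>K\<^esub> B) (B \<boxtimes>\<^bsub>K\<^esub> A) \<psi> id
         \<circ> reassoc_left K B A (B \<boxtimes>\<^bsub>K\<^esub> A)) t)"

text \<open>\<open>\<eta>: K \<rightarrow> M\<close> is a unit map for \<open>\<mu>: M \<otimes> M \<rightarrow> M\<close>, that is, \<open>\<mu> (\<eta> \<otimes> id)\<close> and
  \<open>\<mu> (id \<otimes> \<eta>)\<close> are the canonical maps \<open>K \<otimes> M \<rightarrow> M\<close> and \<open>M \<otimes> K \<rightarrow> M\<close>.\<close>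

definition is_unit_map ::
    "('k, 'r) ring_scheme \<Rightarrow> ('k, 'a, 'm) module_scheme \<Rightarrow> (('a \<times> 'a \<Rightarrow> 'k) set \<Rightarrow> 'a)
      \<Rightarrow> ('k \<Rightarrow> 'a) \<Rightarrow> bool"
  where "is_unit_map K M \<mu> \<eta> \<longleftrightarrow>
    \<eta> \<in> linear_maps K (self_module K) M \<and>
    (\<forall>c\<in>carrier K. \<forall>t\<in>carrier M.
      \<mu> (pure_tensor K M M (\<eta> c) t) = c \<odot>\<^bsub>M\<^esub> t \<and>
      \<mu> (pure_tensor K M M t (\<eta> c)) = c \<odot>\<^bsub>M\<^esub> t)"

definition twisted_product ::
    "('k, 'r) ring_scheme \<Rightarrow> ('k, 'a, 'm) module_scheme \<Rightarrow> ('k, 'b, 'n) module_scheme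
      \<Rightarrow> (('b \<times> 'a \<Rightarrow> 'k) set \<Rightarrow> ('a \<times> 'b \<Rightarrow> 'k) set)
      \<Rightarrow> ('k \<Rightarrow> ('a \<times> 'b \<Rightarrow> 'k) set) \<Rightarrow> ('k, ('a \<times> 'b \<Rightarrow> 'k) set) module"
  where "twisted_product K A B \<psi> \<eta> = (A \<boxtimes>\<^bsub>K\<^esub> B)
    \<lparr>mult := (\<lambda>s t. twisted_mult K A B \<psi> (pure_tensor K (A \<boxtimes>\<^bsub>K\<^esub> B) (A \<boxtimes>\<^bsub>K\<^esub> B) s t)),
     one := \<eta> \<one>\<^bsub>K\<^esub>\<rparr>"

text \<open>\<open>i\<^sub>A(a) = a z\<^sub>A \<otimes> z\<^sub>B\<close> and \<open>i\<^sub>B(b) = z\<^sub>A \<otimes> z\<^sub>B b\<close>, where \<open>z\<^sub>A \<otimes> z\<^sub>B\<close> is Sweedler-type notation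
  for the tensor \<open>\<eta>(1)\<close>, which need not be pure.\<close>

definition twist_incl_left ::
    "('k, 'r) ring_scheme \<Rightarrow> ('k, 'a, 'm) module_scheme \<Rightarrow> ('k, 'b, 'n) module_scheme
      \<Rightarrow> ('k \<Rightarrow> ('a \<times> 'b \<Rightarrow> 'k) set) \<Rightarrow> 'a \<Rightarrow> ('a \<times> 'b \<Rightarrow> 'k) set"
  where "twist_incl_left K A B \<eta> a = tensor_map K A B (\<lambda>x. a \<otimes>\<^bsub>A\<^esub> x) id (\<eta> \<one>\<^bsub>K\<^esub>)"

definition twist_incl_right ::
    "('k, 'r) ring_scheme \<Rightarrow> ('k, 'a, 'm) module_scheme \<Rightarrow> ('k, 'b, 'n) module_scheme
      \<Rightarrow> ('k \<Rightarrow> ('a \<times> 'b \<Rightarrow> 'k) set) \<Rightarrow> 'b \<Rightarrow> ('a \<times> 'b \<Rightarrow> 'k) set"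
  where "twist_incl_right K A B \<eta> b = tensor_map K A B id (\<lambda>y. y \<otimes>\<^bsub>B\<^esub> b) (\<eta> \<one>\<^bsub>K\<^esub>)"

end

theory Submission
  imports Defs
begin

text \<open>The morphism is \<open>\<omega> = m\<^sub>X (j\<^sub>A \<otimes> j\<^sub>B)\<close>, that is, \<open>\<omega>(a \<otimes> b) = j\<^sub>A(a) j\<^sub>B(b)\<close>. It is unital because the
  compatibility of \<open>j\<^sub>A\<close> and \<open>j\<^sub>B\<close> with \<open>\<eta>\<^sub>\<psi>\<close> says exactly that \<open>\<omega>(z\<^sub>A \<otimes> z\<^sub>B) = 1\<close>. It is multiplicative
  because \<open>(a \<otimes> b)(a' \<otimes> b') = a \<psi>(b \<otimes> a') b'\<close> and \<open>\<omega>(a t b') = j\<^sub>A(a) \<omega>(t) j\<^sub>B(b')\<close>, while the exchange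
  condition says \<open>\<omega>(\<psi>(b \<otimes> a')) = j\<^sub>B(b) j\<^sub>A(a')\<close>; so the image of the product is
  \<open>j\<^sub>A(a) j\<^sub>B(b) j\<^sub>A(a') j\<^sub>B(b')\<close> (lemma \<open>mult_lift_twisted_mult\<close>). The same translation rule (lemma
  \<open>mult_lift_tensor_map\<close>) gives \<open>\<omega>(a z\<^sub>A \<otimes> z\<^sub>B) = j\<^sub>A(a) \<omega>(z\<^sub>A \<otimes> z\<^sub>B) = j\<^sub>A(a)\<close> and likewise
  \<open>\<omega>(z\<^sub>A \<otimes> z\<^sub>B b) = j\<^sub>B(b)\<close>.

  To make this argument available for tensor products that are built as quotients of free modules,
  one needs their universal property (lemmas \<open>tensor_lift_linear\<close> and \<open>tensor_lift_pure\<close>) and the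
  fact that additive identities may be checked on pure tensors (lemma \<open>tensor_induct\<close>). These
  show that the tensor maps and reassociations that make up \<open>m\<^sub>\<psi>\<close> are linear and have the
  expected values on pure tensors.\<close>


section \<open>Linear and bilinear maps\<close>

lemma linear_mapsI:
  assumes "\<And>x. x \<in> carrier M \<Longrightarrow> f x \<in> carrier N"
    and "\<And>x y. \<lbrakk>x \<in> carrier M; y \<in> carrier M\<rbrakk> \<Longrightarrow> f (x \<oplus>\<^bsub>M\<^esub> y) = f x \<oplus>\<^bsub>N\<^esub> f y"
    and "\<And>c x. \<lbrakk>c \<in> carrier K; x \<in> carrier M\<rbrakk> \<Longrightarrow> f (c \<odot>\<^bsub>M\<^esub> x) = c \<odot>\<^bsub>N\<^esub> f x"
  shows "f \<in> linear_maps K M N"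
  using assms by (auto simp: linear_maps_def)

lemma linear_maps_closed: "\<lbrakk>f \<in> linear_maps K M N; x \<in> carrier M\<rbrakk> \<Longrightarrow> f x \<in> carrier N"
  by (auto simp: linear_maps_def)

lemma linear_maps_add:
  "\<lbrakk>f \<in> linear_maps K M N; x \<in> carrier M; y \<in> carrier M\<rbrakk> \<Longrightarrow> f (x \<oplus>\<^bsub>M\<^esub> y) = f x \<oplus>\<^bsub>N\<^esub> f y"
  by (auto simp: linear_maps_def)

lemma linear_maps_smult:
  "\<lbrakk>f \<in> linear_maps K M N; c \<in> carrier K; x \<in> carrier M\<rbrakk> \<Longrightarrow> f (c \<odot>\<^bsub>M\<^esub> x) = c \<odot>\<^bsub>N\<^esub> f x"
  by (auto simp: linear_maps_def)

lemmas linear_maps_rules = linear_maps_closed linear_maps_add linear_maps_smult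

lemma linear_maps_id: "id \<in> linear_maps K M M"
  by (auto simp: linear_maps_def)

lemma linear_maps_comp:
  "\<lbrakk>g \<in> linear_maps K N P; f \<in> linear_maps K M N\<rbrakk> \<Longrightarrow> g \<circ> f \<in> linear_maps K M P"
  by (auto simp: linear_maps_def Pi_iff)

lemma linear_maps_zero:
  assumes "module K M" "module K N" "f \<in> linear_maps K M N"
  shows "f \<zero>\<^bsub>M\<^esub> = \<zero>\<^bsub>N\<^esub>"
proof -
  interpret M: module K M by fact
  interpret N: module K N by fact
  have "f (\<zero>\<^bsub>K\<^esub> \<odot>\<^bsub>M\<^esub> \<zero>\<^bsub>M\<^esub>) = \<zero>\<^bsub>K\<^esub> \<odot>\<^bsub>N\<^esub> f \<zero>\<^bsub>M\<^esub>"
    by (rule linear_maps_smult[OF assms(3)]) auto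
  then show ?thesis using linear_maps_closed[OF assms(3)] by simp
qed

lemma linear_maps_uminus:
  assumes "module K M" "module K N" "f \<in> linear_maps K M N" "x \<in> carrier M"
  shows "f (\<ominus>\<^bsub>M\<^esub> x) = \<ominus>\<^bsub>N\<^esub> f x"
proof -
  interpret M: module K M by fact
  interpret N: module K N by fact
  have "f ((\<ominus>\<^bsub>K\<^esub> \<one>\<^bsub>K\<^esub>) \<odot>\<^bsub>M\<^esub> x) = (\<ominus>\<^bsub>K\<^esub> \<one>\<^bsub>K\<^esub>) \<odot>\<^bsub>N\<^esub> f x"
    by (rule linear_maps_smult[OF assms(3)]) (use assms in auto)
  then show ?thesis using linear_maps_closed[OF assms(3)] assms(4)
    by (simp add: M.smult_l_minus N.smult_l_minus)
qed

lemma linear_maps_minus: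
  assumes "module K M" "module K N" "f \<in> linear_maps K M N" "x \<in> carrier M" "y \<in> carrier M"
  shows "f (x \<ominus>\<^bsub>M\<^esub> y) = f x \<ominus>\<^bsub>N\<^esub> f y"
proof -
  interpret M: module K M by fact
  interpret N: module K N by fact
  show ?thesis using assms
    by (simp add: a_minus_def linear_maps_add linear_maps_uminus)
qed

text \<open>For showing that a map vanishes on the span of a set from its vanishing on the set.\<close>

lemma submodule_kernel:
  assumes "module K M" "module K N" "f \<in> linear_maps K M N"
  shows "submodule {x \<in> carrier M. f x = \<zero>\<^bsub>N\<^esub>} K M"
proof -
  interpret M: module K M by fact
  interpret N: module K N by fact
  show ?thesis
    by (rule M.submoduleI)
      (auto simp: linear_maps_zero[OF assms] linear_maps_uminus[OF assms]
         linear_maps_add[OF assms(3)] linear_maps_smult[OF assms(3)])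
qed

definition bilinear_maps ::
    "('k, 'r) ring_scheme \<Rightarrow> ('k, 'a, 'm) module_scheme \<Rightarrow> ('k, 'b, 'n) module_scheme
      \<Rightarrow> ('k, 'c, 'p) module_scheme \<Rightarrow> ('a \<Rightarrow> 'b \<Rightarrow> 'c) set"
  where "bilinear_maps K M N P =
    {f. (\<forall>x\<in>carrier M. f x \<in> linear_maps K N P) \<and>
        (\<forall>y\<in>carrier N. (\<lambda>x. f x y) \<in> linear_maps K M P)}"

lemma bilinear_mapsI:
  assumes "\<And>x. x \<in> carrier M \<Longrightarrow> f x \<in> linear_maps K N P"
    and "\<And>y. y \<in> carrier N \<Longrightarrow> (\<lambda>x. f x y) \<in> linear_maps K M P"
  shows "f \<in> bilinear_maps K M N P"
  using assms by (auto simp: bilinear_maps_def)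

lemma bilinear_maps_left:
  "\<lbrakk>f \<in> bilinear_maps K M N P; y \<in> carrier N\<rbrakk> \<Longrightarrow> (\<lambda>x. f x y) \<in> linear_maps K M P"
  by (auto simp: bilinear_maps_def)

lemma bilinear_maps_right:
  "\<lbrakk>f \<in> bilinear_maps K M N P; x \<in> carrier M\<rbrakk> \<Longrightarrow> f x \<in> linear_maps K N P"
  by (auto simp: bilinear_maps_def)

lemma bilinear_maps_closed:
  "\<lbrakk>f \<in> bilinear_maps K M N P; x \<in> carrier M; y \<in> carrier N\<rbrakk> \<Longrightarrow> f x y \<in> carrier P"
  by (auto simp: bilinear_maps_def linear_maps_def)

lemma bilinear_maps_comp:
  assumes "f \<in> bilinear_maps K M N P" "g \<in> linear_maps K M' M" "h \<in> linear_maps K N' N"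
  shows "(\<lambda>x y. f (g x) (h y)) \<in> bilinear_maps K M' N' P"
  using assms unfolding bilinear_maps_def linear_maps_def by (auto simp: Pi_iff)


section \<open>The free module\<close>

lemma free_module_sel:
  "carrier (free_module K S) =
     {f. range f \<subseteq> carrier K \<and> {s. f s \<noteq> \<zero>\<^bsub>K\<^esub>} \<subseteq> S \<and> finite {s. f s \<noteq> \<zero>\<^bsub>K\<^esub>}}"
  "zero (free_module K S) = (\<lambda>s. \<zero>\<^bsub>K\<^esub>)"
  "add (free_module K S) = (\<lambda>f g s. f s \<oplus>\<^bsub>K\<^esub> g s)"
  "smult (free_module K S) = (\<lambda>c f s. c \<otimes>\<^bsub>K\<^esub> f s)"
  by (simp_all add: free_module_def)

lemma free_module_module:
  assumes "cring K"
  shows "module K (free_module K S)"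
proof -
  interpret cring K by fact
  let ?F = "free_module K S"
  have ran: "f s \<in> carrier K" if "f \<in> carrier ?F" for f s
    using that by (auto simp: free_module_sel)
  have addc: "(\<lambda>s. f s \<oplus>\<^bsub>K\<^esub> g s) \<in> carrier ?F" if "f \<in> carrier ?F" "g \<in> carrier ?F" for f g
  proof -
    have sub: "{s. f s \<oplus>\<^bsub>K\<^esub> g s \<noteq> \<zero>\<^bsub>K\<^esub>} \<subseteq> {s. f s \<noteq> \<zero>\<^bsub>K\<^esub>} \<union> {s. g s \<noteq> \<zero>\<^bsub>K\<^esub>}"
      by auto
    moreover have "finite ({s. f s \<noteq> \<zero>\<^bsub>K\<^esub>} \<union> {s. g s \<noteq> \<zero>\<^bsub>K\<^esub>})"
      using that by (auto simp: free_module_sel)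
    ultimately have "finite {s. f s \<oplus>\<^bsub>K\<^esub> g s \<noteq> \<zero>\<^bsub>K\<^esub>}" by (rule finite_subset)
    moreover have "{s. f s \<oplus>\<^bsub>K\<^esub> g s \<noteq> \<zero>\<^bsub>K\<^esub>} \<subseteq> S"
      using sub that by (auto simp: free_module_sel)
    ultimately show ?thesis using ran[OF that(1)] ran[OF that(2)]
      by (auto simp: free_module_sel)
  qed
  have smc: "(\<lambda>s. c \<otimes>\<^bsub>K\<^esub> f s) \<in> carrier ?F" if "c \<in> carrier K" "f \<in> carrier ?F" for c f
  proof -
    have sub: "{s. c \<otimes>\<^bsub>K\<^esub> f s \<noteq> \<zero>\<^bsub>K\<^esub>} \<subseteq> {s. f s \<noteq> \<zero>\<^bsub>K\<^esub>}"
      using that(1) by auto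
    have "finite {s. f s \<noteq> \<zero>\<^bsub>K\<^esub>}" "{s. f s \<noteq> \<zero>\<^bsub>K\<^esub>} \<subseteq> S"
      using that by (auto simp: free_module_sel)
    then have "finite {s. c \<otimes>\<^bsub>K\<^esub> f s \<noteq> \<zero>\<^bsub>K\<^esub>}" "{s. c \<otimes>\<^bsub>K\<^esub> f s \<noteq> \<zero>\<^bsub>K\<^esub>} \<subseteq> S"
      using sub by (auto intro: finite_subset)
    then show ?thesis using that ran[OF that(2)]
      by (auto simp: free_module_sel)
  qed
  have inv: "\<exists>g\<in>carrier ?F. (\<lambda>s. g s \<oplus>\<^bsub>K\<^esub> f s) = (\<lambda>s. \<zero>\<^bsub>K\<^esub>)" if "f \<in> carrier ?F" for f
  proof
    show "(\<lambda>s. (\<ominus>\<^bsub>K\<^esub> \<one>\<^bsub>K\<^esub>) \<otimes>\<^bsub>K\<^esub> f s) \<in> carrier ?F" by (rule smc) (use that in auto)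
    show "(\<lambda>s. (\<ominus>\<^bsub>K\<^esub> \<one>\<^bsub>K\<^esub>) \<otimes>\<^bsub>K\<^esub> f s \<oplus>\<^bsub>K\<^esub> f s) = (\<lambda>s. \<zero>\<^bsub>K\<^esub>)"
      using ran[OF that] by (simp add: l_minus l_neg)
  qed
  show ?thesis
  proof (rule moduleI)
    show "abelian_group ?F"
    proof (rule abelian_groupI)
      show "\<zero>\<^bsub>?F\<^esub> \<in> carrier ?F" by (simp add: free_module_sel)
    next
      fix x assume "x \<in> carrier ?F"
      then show "\<exists>y\<in>carrier ?F. y \<oplus>\<^bsub>?F\<^esub> x = \<zero>\<^bsub>?F\<^esub>"
        using inv by (simp add: free_module_sel(2-))
    qed (use addc ran in \<open>simp_all add: free_module_sel(2-) a_ac\<close>)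
  qed (use smc ran in \<open>simp_all add: free_module_sel(2-) is_cring l_distr r_distr m_assoc\<close>)
qed

lemma free_gen_closed: "\<lbrakk>cring K; s \<in> S\<rbrakk> \<Longrightarrow> free_gen K s \<in> carrier (free_module K S)"
proof -
  assume "cring K" "s \<in> S"
  interpret cring K by fact
  have "finite {t. free_gen K s t \<noteq> \<zero>\<^bsub>K\<^esub>}"
    by (rule finite_subset[of _ "{s}"]) (auto simp: free_gen_def)
  with \<open>s \<in> S\<close> show ?thesis by (auto simp: free_module_sel free_gen_def split: if_splits)
qed

text \<open>A finitely supported function is the sum of its values times generators; peeling off one
  point of the support at a time avoids writing down this sum.\<close>

lemma free_module_induct [consumes 2, case_names zero gen add]:
  fixes h :: "'s \<Rightarrow> 'k"
  assumes "cring K" and h: "h \<in> carrier (free_module K S)"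
    and zero: "P \<zero>\<^bsub>free_module K S\<^esub>"
    and gen: "\<And>c s. \<lbrakk>c \<in> carrier K; s \<in> S\<rbrakk> \<Longrightarrow> P (c \<odot>\<^bsub>free_module K S\<^esub> free_gen K s)"
    and add: "\<And>f g. \<lbrakk>f \<in> carrier (free_module K S); g \<in> carrier (free_module K S); P f; P g\<rbrakk>
        \<Longrightarrow> P (f \<oplus>\<^bsub>free_module K S\<^esub> g)"
  shows "P h"
proof -
  interpret cring K by fact
  interpret F: module K "free_module K S" by (rule free_module_module) fact
  have "\<forall>h. h \<in> carrier (free_module K S) \<longrightarrow> {s. h s \<noteq> \<zero>\<^bsub>K\<^esub>} \<subseteq> T \<longrightarrow> P h"
    if "finite T" "T \<subseteq> S" for T
    using that
  proof (induction T)
    case empty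
    show ?case
    proof (intro allI impI)
      fix h :: "'s \<Rightarrow> 'k" assume "{s. h s \<noteq> \<zero>\<^bsub>K\<^esub>} \<subseteq> {}"
      then have "h = \<zero>\<^bsub>free_module K S\<^esub>" by (auto simp: free_module_sel)
      with zero show "P h" by simp
    qed
  next
    case (insert s T)
    show ?case
    proof (intro allI impI)
      fix h :: "'s \<Rightarrow> 'k" assume h: "h \<in> carrier (free_module K S)" "{t. h t \<noteq> \<zero>\<^bsub>K\<^esub>} \<subseteq> insert s T"
      then have K: "h t \<in> carrier K" for t by (auto simp: free_module_sel)
      let ?g = "h(s := \<zero>\<^bsub>K\<^esub>)"
      have "finite {t. ?g t \<noteq> \<zero>\<^bsub>K\<^esub>}" "{t. ?g t \<noteq> \<zero>\<^bsub>K\<^esub>} \<subseteq> T"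
        using h(2) insert by (auto split: if_splits intro: finite_subset[of _ T])
      then have g: "?g \<in> carrier (free_module K S)"
        using h(1) by (auto simp: free_module_sel)
      with insert \<open>{t. ?g t \<noteq> \<zero>\<^bsub>K\<^esub>} \<subseteq> T\<close> have "P ?g" by blast
      have "h = h s \<odot>\<^bsub>free_module K S\<^esub> free_gen K s \<oplus>\<^bsub>free_module K S\<^esub> ?g"
        using K by (auto simp: free_module_sel free_gen_def fun_eq_iff)
      moreover have "P (h s \<odot>\<^bsub>free_module K S\<^esub> free_gen K s \<oplus>\<^bsub>free_module K S\<^esub> ?g)"
        using g \<open>P ?g\<close> K insert.prems by (intro add gen F.smult_closed free_gen_closed \<open>cring K\<close>) auto
      ultimately show "P h" by simp
    qed
  qed
  from this[of "{s. h s \<noteq> \<zero>\<^bsub>K\<^esub>}"] h show ?thesis by (auto simp: free_module_sel)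
qed

text \<open>The linear extension of a map on the generators to the free module.\<close>

definition free_lift ::
    "('k, 'r) ring_scheme \<Rightarrow> ('k, 'c, 'p) module_scheme \<Rightarrow> ('s \<Rightarrow> 'c) \<Rightarrow> ('s \<Rightarrow> 'k) \<Rightarrow> 'c"
  where "free_lift K P f h = (\<Oplus>\<^bsub>P\<^esub>s\<in>{s. h s \<noteq> \<zero>\<^bsub>K\<^esub>}. h s \<odot>\<^bsub>P\<^esub> f s)"

text \<open>The sum in the definition runs over the support of its argument, which changes under addition
  and scaling. Extending each sum by zero terms to a common finite index set makes them
  comparable.\<close>

lemma free_lift_linear:
  assumes "module K P" and f: "\<And>s. s \<in> S \<Longrightarrow> f s \<in> carrier P"
  shows "free_lift K P f \<in> linear_maps K (free_module K S) P"
proof -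
  interpret P: module K P by fact
  let ?F = "free_module K S"
  interpret F: module K ?F by (rule free_module_module) (rule P.R.is_cring)
  have term_closed: "h s \<odot>\<^bsub>P\<^esub> f s \<in> carrier P" if "h \<in> carrier ?F" "s \<in> S" for h s
    using that f by (intro P.smult_closed) (auto simp: free_module_sel)
  have ext: "free_lift K P f h = (\<Oplus>\<^bsub>P\<^esub>s\<in>T. h s \<odot>\<^bsub>P\<^esub> f s)"
    if "h \<in> carrier ?F" "finite T" "{s. h s \<noteq> \<zero>\<^bsub>K\<^esub>} \<subseteq> T" "T \<subseteq> S" for h T
    unfolding free_lift_def using that term_closed[OF that(1)] f
    by (intro P.add.finprod_mono_neutral_cong_left) (auto simp: subset_iff)
  show ?thesis
  proof (rule linear_mapsI)
    fix h assume h: "h \<in> carrier ?F"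
    then have "{s. h s \<noteq> \<zero>\<^bsub>K\<^esub>} \<subseteq> S" by (simp add: free_module_sel)
    with h show "free_lift K P f h \<in> carrier P"
      unfolding free_lift_def by (intro P.finsum_closed) (auto intro!: term_closed)
  next
    fix g h assume gh: "g \<in> carrier ?F" "h \<in> carrier ?F"
    let ?T = "{s. g s \<noteq> \<zero>\<^bsub>K\<^esub>} \<union> {s. h s \<noteq> \<zero>\<^bsub>K\<^esub>}"
    have T: "finite ?T" "?T \<subseteq> S" using gh by (auto simp: free_module_sel)
    have K: "g s \<in> carrier K" "h s \<in> carrier K" for s using gh by (auto simp: free_module_sel)
    have "free_lift K P f (g \<oplus>\<^bsub>?F\<^esub> h) = (\<Oplus>\<^bsub>P\<^esub>s\<in>?T. (g \<oplus>\<^bsub>?F\<^esub> h) s \<odot>\<^bsub>P\<^esub> f s)"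
    proof (rule ext)
      show "{s. (g \<oplus>\<^bsub>?F\<^esub> h) s \<noteq> \<zero>\<^bsub>K\<^esub>} \<subseteq> ?T" by (auto simp: free_module_sel(3))
    qed (use gh T in auto)
    also have "\<dots> = (\<Oplus>\<^bsub>P\<^esub>s\<in>?T. g s \<odot>\<^bsub>P\<^esub> f s \<oplus>\<^bsub>P\<^esub> h s \<odot>\<^bsub>P\<^esub> f s)"
      using T K f by (intro P.finsum_cong') (auto simp: free_module_sel(3) P.smult_l_distr subset_iff)
    also have "\<dots> = (\<Oplus>\<^bsub>P\<^esub>s\<in>?T. g s \<odot>\<^bsub>P\<^esub> f s) \<oplus>\<^bsub>P\<^esub> (\<Oplus>\<^bsub>P\<^esub>s\<in>?T. h s \<odot>\<^bsub>P\<^esub> f s)"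
      using T K f by (intro P.finsum_addf) (auto simp: subset_iff)
    also have "\<dots> = free_lift K P f g \<oplus>\<^bsub>P\<^esub> free_lift K P f h"
      using gh T by (simp add: ext[of g ?T] ext[of h ?T])
    finally show "free_lift K P f (g \<oplus>\<^bsub>?F\<^esub> h) = free_lift K P f g \<oplus>\<^bsub>P\<^esub> free_lift K P f h" .
  next
    fix c h assume ch: "c \<in> carrier K" "h \<in> carrier ?F"
    let ?T = "{s. h s \<noteq> \<zero>\<^bsub>K\<^esub>}"
    have T: "finite ?T" "?T \<subseteq> S" using ch by (auto simp: free_module_sel)
    have K: "h s \<in> carrier K" for s using ch by (auto simp: free_module_sel)
    have "free_lift K P f (c \<odot>\<^bsub>?F\<^esub> h) = (\<Oplus>\<^bsub>P\<^esub>s\<in>?T. (c \<odot>\<^bsub>?F\<^esub> h) s \<odot>\<^bsub>P\<^esub> f s)"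
    proof (rule ext)
      show "{s. (c \<odot>\<^bsub>?F\<^esub> h) s \<noteq> \<zero>\<^bsub>K\<^esub>} \<subseteq> ?T" using ch(1) by (auto simp: free_module_sel(4))
    qed (use ch T in auto)
    also have "\<dots> = (\<Oplus>\<^bsub>P\<^esub>s\<in>?T. c \<odot>\<^bsub>P\<^esub> (h s \<odot>\<^bsub>P\<^esub> f s))"
      using T K f ch by (intro P.finsum_cong') (auto simp: free_module_sel(4) P.smult_assoc1 subset_iff)
    also have "\<dots> = c \<odot>\<^bsub>P\<^esub> free_lift K P f h"
      unfolding free_lift_def
      using T K f ch by (intro P.finsum_smult_ldistr[symmetric]) (auto simp: subset_iff)
    finally show "free_lift K P f (c \<odot>\<^bsub>?F\<^esub> h) = c \<odot>\<^bsub>P\<^esub> free_lift K P f h" .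
  qed
qed

lemma free_lift_gen:
  assumes "module K P" "f s \<in> carrier P"
  shows "free_lift K P f (free_gen K s) = f s"
proof -
  interpret P: module K P by fact
  show ?thesis
  proof (cases "\<one>\<^bsub>K\<^esub> = \<zero>\<^bsub>K\<^esub>")
    case True
    \<comment> \<open>Over the zero ring the support of a generator is empty, but then \<open>P\<close> is zero.\<close>
    have "f s = \<one>\<^bsub>K\<^esub> \<odot>\<^bsub>P\<^esub> f s" using assms by simp
    also have "\<dots> = \<zero>\<^bsub>P\<^esub>" using assms by (simp add: True)
    finally show ?thesis by (simp add: free_lift_def free_gen_def True)
  next
    case False
    then have "{t. free_gen K s t \<noteq> \<zero>\<^bsub>K\<^esub>} = {s}" by (auto simp: free_gen_def)
    then show ?thesis using assms by (simp add: free_lift_def free_gen_def)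
  qed
qed


section \<open>Quotient modules\<close>

lemma quot_module_sel:
  "carrier (quot_module M H) = a_rcosets\<^bsub>M\<^esub> H"
  "zero (quot_module M H) = H"
  "add (quot_module M H) = (\<lambda>X Y. X <+>\<^bsub>M\<^esub> Y)"
  "smult (quot_module M H) = (\<lambda>c X. \<Union>x\<in>X. H +>\<^bsub>M\<^esub> (c \<odot>\<^bsub>M\<^esub> x))"
  by (simp_all add: quot_module_def)

lemma submodule_abelian_subgroup:
  assumes "module K M" "submodule H K M"
  shows "abelian_subgroup H M"
proof -
  interpret M: module K M by fact
  show ?thesis
    using assms(2) by (intro abelian_subgroupI3 additive_subgroupI)
      (auto dest: submodule.axioms(1) intro: M.abelian_group_axioms)
qed

lemma coset_eqI:
  assumes "module K M" "submodule H K M" "x \<in> carrier M" "y \<in> carrier M" "x \<ominus>\<^bsub>M\<^esub> y \<in> H"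
  shows "H +>\<^bsub>M\<^esub> x = H +>\<^bsub>M\<^esub> y"
proof -
  interpret M: module K M by fact
  interpret H: abelian_subgroup H M by (rule submodule_abelian_subgroup) fact+
  have "x \<in> H +>\<^bsub>M\<^esub> y" using assms by (simp add: H.a_rcos_module a_minus_def)
  then show ?thesis using H.a_repr_independence'[of x y] assms by simp
qed

text \<open>The union that defines scalar multiplication on the quotient is over equal cosets, since
  \<open>c\<close> times an element of \<open>H\<close> is again in \<open>H\<close>.\<close>

lemma quot_module_smult_coset:
  assumes "module K M" "submodule H K M" "c \<in> carrier K" "x \<in> carrier M"
  shows "c \<odot>\<^bsub>quot_module M H\<^esub> (H +>\<^bsub>M\<^esub> x) = H +>\<^bsub>M\<^esub> (c \<odot>\<^bsub>M\<^esub> x)"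
proof -
  interpret M: module K M by fact
  interpret H: abelian_subgroup H M by (rule submodule_abelian_subgroup) fact+
  have eq: "H +>\<^bsub>M\<^esub> (c \<odot>\<^bsub>M\<^esub> y) = H +>\<^bsub>M\<^esub> (c \<odot>\<^bsub>M\<^esub> x)" if y: "y \<in> H +>\<^bsub>M\<^esub> x" for y
  proof -
    have yc: "y \<in> carrier M" using y assms H.a_elemrcos_carrier M.abelian_group_axioms by blast
    have "y \<ominus>\<^bsub>M\<^esub> x \<in> H" using y yc assms by (simp add: H.a_rcos_module a_minus_def)
    then have "c \<odot>\<^bsub>M\<^esub> (y \<ominus>\<^bsub>M\<^esub> x) \<in> H" using assms(2,3) by (auto intro: submodule.smult_closed)
    also have "c \<odot>\<^bsub>M\<^esub> (y \<ominus>\<^bsub>M\<^esub> x) = c \<odot>\<^bsub>M\<^esub> y \<ominus>\<^bsub>M\<^esub> c \<odot>\<^bsub>M\<^esub> x"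
      using assms yc by (simp add: a_minus_def M.smult_r_distr M.smult_r_minus)
    finally show ?thesis using assms yc by (intro coset_eqI[OF assms(1,2)]) auto
  qed
  have ne: "H +>\<^bsub>M\<^esub> x \<noteq> {}" using assms H.a_rcos_self by blast
  have "c \<odot>\<^bsub>quot_module M H\<^esub> (H +>\<^bsub>M\<^esub> x) = (\<Union>y\<in>H +>\<^bsub>M\<^esub> x. H +>\<^bsub>M\<^esub> (c \<odot>\<^bsub>M\<^esub> y))"
    by (simp add: quot_module_sel(4))
  also have "\<dots> = (\<Union>y\<in>H +>\<^bsub>M\<^esub> x. H +>\<^bsub>M\<^esub> (c \<odot>\<^bsub>M\<^esub> x))"
    by (rule SUP_cong[OF refl eq])
  also have "\<dots> = H +>\<^bsub>M\<^esub> (c \<odot>\<^bsub>M\<^esub> x)" using ne by (simp only: UN_constant if_False)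
  finally show ?thesis .
qed

lemma quot_module_cosetE:
  assumes "X \<in> carrier (quot_module M H)"
  obtains x where "x \<in> carrier M" "X = H +>\<^bsub>M\<^esub> x"
  using assms by (auto simp: quot_module_sel A_RCOSETS_def')

lemma coset_linear:
  assumes "module K M" "submodule H K M"
  shows "(\<lambda>x. H +>\<^bsub>M\<^esub> x) \<in> linear_maps K M (quot_module M H)"
proof -
  interpret M: module K M by fact
  interpret H: abelian_subgroup H M by (rule submodule_abelian_subgroup) fact+
  show ?thesis
    by (rule linear_mapsI)
      (auto simp: quot_module_smult_coset[OF assms] quot_module_sel(1-3) H.a_rcos_sum
        A_RCOSETS_def')
qed

text \<open>Every module law of the quotient is the image of the same law in \<open>M\<close> under the coset map.\<close>

lemma quot_module_module:
  assumes "module K M" "submodule H K M"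
  shows "module K (quot_module M H)"
proof -
  interpret M: module K M by fact
  interpret H: abelian_subgroup H M by (rule submodule_abelian_subgroup) fact+
  let ?Q = "quot_module M H"
  note coset = linear_maps_closed[OF coset_linear[OF assms]]
  note [simp] = quot_module_smult_coset[OF assms] linear_maps_add[OF coset_linear[OF assms], symmetric]
  have zero: "\<zero>\<^bsub>?Q\<^esub> = H +>\<^bsub>M\<^esub> \<zero>\<^bsub>M\<^esub>"
    using H.a_subset by (simp add: quot_module_sel)
  show ?thesis
  proof (rule moduleI)
    show "abelian_group ?Q"
    proof (rule abelian_groupI)
      show "\<zero>\<^bsub>?Q\<^esub> \<in> carrier ?Q" unfolding zero by (rule coset) simp
    next
      fix X assume "X \<in> carrier ?Q"
      then obtain x where x: "x \<in> carrier M" "X = H +>\<^bsub>M\<^esub> x" by (rule quot_module_cosetE)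
      then show "\<zero>\<^bsub>?Q\<^esub> \<oplus>\<^bsub>?Q\<^esub> X = X"
        unfolding zero by (simp del: M.a_coset_add_zero)
      have "(H +>\<^bsub>M\<^esub> (\<ominus>\<^bsub>M\<^esub> x)) \<oplus>\<^bsub>?Q\<^esub> X = \<zero>\<^bsub>?Q\<^esub>"
        using x unfolding zero by (simp add: M.l_neg del: M.a_coset_add_zero)
      with x show "\<exists>Y\<in>carrier ?Q. Y \<oplus>\<^bsub>?Q\<^esub> X = \<zero>\<^bsub>?Q\<^esub>" using coset[of "\<ominus>\<^bsub>M\<^esub> x"] by blast
    qed (elim quot_module_cosetE, simp add: coset M.a_ac)+
  qed (use M.R.is_cring in simp, (elim quot_module_cosetE, simp add: coset
      M.smult_l_distr M.smult_r_distr M.smult_assoc1)+)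
qed


section \<open>Tensor products and their universal property\<close>

lemma submodule_span_submodule:
  assumes "module K M" "S \<subseteq> carrier M"
  shows "submodule (submodule_span K M S) K M"
proof -
  interpret M: module K M by fact
  show ?thesis
  proof (rule M.submoduleI)
    show "submodule_span K M S \<subseteq> carrier M"
      using M.carrier_is_submodule assms(2) by (auto simp: submodule_span_def)
    show "\<zero>\<^bsub>M\<^esub> \<in> submodule_span K M S"
      by (auto simp: submodule_span_def dest!: submodule.axioms(1) dest: subgroup.one_closed)
  qed (auto simp: submodule_span_def M.submoduleE)
qed

lemma submodule_span_base: "S \<subseteq> submodule_span K M S"
  by (auto simp: submodule_span_def)

lemma submodule_span_least: "\<lbrakk>submodule H K M; S \<subseteq> H\<rbrakk> \<Longrightarrow> submodule_span K M S \<subseteq> H"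
  by (auto simp: submodule_span_def)

lemma bilinear_relations_closed:
  assumes "module K M" "module K N"
  shows "bilinear_relations K M N \<subseteq> carrier (free_module K (carrier M \<times> carrier N))"
proof -
  interpret M: module K M by fact
  interpret N: module K N by fact
  interpret F: module K "free_module K (carrier M \<times> carrier N)"
    by (rule free_module_module) (rule M.R.is_cring)
  show ?thesis
    unfolding bilinear_relations_def Let_def
    by (auto intro!: F.minus_closed F.add.m_closed F.smult_closed free_gen_closed[OF M.R.is_cring])
qed

lemma tensor_null_submodule:
  assumes "module K M" "module K N"
  shows "submodule (tensor_null K M N) K (free_module K (carrier M \<times> carrier N))"
  unfolding tensor_null_def
  by (intro submodule_span_submodule free_module_module bilinear_relations_closed assms)
    (use assms in \<open>auto simp: module_def\<close>)

lemma tensor_module: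
  assumes "module K M" "module K N"
  shows "module K (M \<boxtimes>\<^bsub>K\<^esub> N)"
  unfolding tensor_def
  by (intro quot_module_module free_module_module tensor_null_submodule assms)
    (use assms in \<open>auto simp: module_def\<close>)

lemma pure_tensor_bilinear:
  assumes "module K M" "module K N"
  shows "pure_tensor K M N \<in> bilinear_maps K M N (M \<boxtimes>\<^bsub>K\<^esub> N)"
proof -
  interpret M: module K M by fact
  interpret N: module K N by fact
  let ?F = "free_module K (carrier M \<times> carrier N)"
  let ?H = "tensor_null K M N"
  have F: "module K ?F" by (rule free_module_module) (rule M.R.is_cring)
  interpret F: module K ?F by (rule F)
  have H: "submodule ?H K ?F" by (rule tensor_null_submodule) fact+
  note coset = coset_linear[OF F H, folded tensor_def]
  note gen = free_gen_closed[OF M.R.is_cring]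
  have rel: "?H +>\<^bsub>?F\<^esub> f = ?H +>\<^bsub>?F\<^esub> g"
    if "f \<ominus>\<^bsub>?F\<^esub> g \<in> bilinear_relations K M N" "f \<in> carrier ?F" "g \<in> carrier ?F" for f g
    using that submodule_span_base[of "bilinear_relations K M N" K ?F]
    by (intro coset_eqI[OF F H]) (auto simp: tensor_null_def)
  show ?thesis
  proof (rule bilinear_mapsI; rule linear_mapsI)
    fix x y y' assume *: "x \<in> carrier M" "y \<in> carrier N" "y' \<in> carrier N"
    have "?H +>\<^bsub>?F\<^esub> free_gen K (x, y \<oplus>\<^bsub>N\<^esub> y')
        = ?H +>\<^bsub>?F\<^esub> (free_gen K (x, y) \<oplus>\<^bsub>?F\<^esub> free_gen K (x, y'))"
      using * by (intro rel gen F.add.m_closed) (auto simp: bilinear_relations_def Let_def)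
    then show "pure_tensor K M N x (y \<oplus>\<^bsub>N\<^esub> y')
        = pure_tensor K M N x y \<oplus>\<^bsub>M \<boxtimes>\<^bsub>K\<^esub> N\<^esub> pure_tensor K M N x y'"
      unfolding pure_tensor_def using * by (simp add: linear_maps_add[OF coset] gen)
  next
    fix x x' y assume *: "x \<in> carrier M" "x' \<in> carrier M" "y \<in> carrier N"
    have "?H +>\<^bsub>?F\<^esub> free_gen K (x \<oplus>\<^bsub>M\<^esub> x', y)
        = ?H +>\<^bsub>?F\<^esub> (free_gen K (x, y) \<oplus>\<^bsub>?F\<^esub> free_gen K (x', y))"
      using * by (intro rel gen F.add.m_closed) (auto simp: bilinear_relations_def Let_def)
    then show "pure_tensor K M N (x \<oplus>\<^bsub>M\<^esub> x') y
        = pure_tensor K M N x y \<oplus>\<^bsub>M \<boxtimes>\<^bsub>K\<^esub> N\<^esub> pure_tensor K M N x' y"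
      unfolding pure_tensor_def using * by (simp add: linear_maps_add[OF coset] gen)
  next
    fix c x y assume *: "c \<in> carrier K" "x \<in> carrier M" "y \<in> carrier N"
    have "?H +>\<^bsub>?F\<^esub> free_gen K (x, c \<odot>\<^bsub>N\<^esub> y) = ?H +>\<^bsub>?F\<^esub> (c \<odot>\<^bsub>?F\<^esub> free_gen K (x, y))"
      using * by (intro rel gen F.smult_closed) (auto simp: bilinear_relations_def Let_def)
    then show "pure_tensor K M N x (c \<odot>\<^bsub>N\<^esub> y) = c \<odot>\<^bsub>M \<boxtimes>\<^bsub>K\<^esub> N\<^esub> pure_tensor K M N x y"
      unfolding pure_tensor_def using * by (simp add: linear_maps_smult[OF coset] gen)
    have "?H +>\<^bsub>?F\<^esub> free_gen K (c \<odot>\<^bsub>M\<^esub> x, y) = ?H +>\<^bsub>?F\<^esub> (c \<odot>\<^bsub>?F\<^esub> free_gen K (x, y))"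
      using * by (intro rel gen F.smult_closed) (auto simp: bilinear_relations_def Let_def)
    then show "pure_tensor K M N (c \<odot>\<^bsub>M\<^esub> x) y = c \<odot>\<^bsub>M \<boxtimes>\<^bsub>K\<^esub> N\<^esub> pure_tensor K M N x y"
      unfolding pure_tensor_def using * by (simp add: linear_maps_smult[OF coset] gen)
  qed (auto simp: pure_tensor_def intro!: linear_maps_closed[OF coset] gen)
qed

lemma pure_tensor_closed:
  "\<lbrakk>module K M; module K N; x \<in> carrier M; y \<in> carrier N\<rbrakk>
    \<Longrightarrow> pure_tensor K M N x y \<in> carrier (M \<boxtimes>\<^bsub>K\<^esub> N)"
  by (rule bilinear_maps_closed[OF pure_tensor_bilinear])

text \<open>Sums of pure tensors already exhaust the tensor product, because scalars and the zero can be
  absorbed into one of the factors. So an identity between additive expressions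
  need only be checked on pure tensors; all later computations rest on this.\<close>

lemma tensor_induct [consumes 3, case_names pure add]:
  assumes "module K M" "module K N" and t: "t \<in> carrier (M \<boxtimes>\<^bsub>K\<^esub> N)"
    and pure: "\<And>x y. \<lbrakk>x \<in> carrier M; y \<in> carrier N\<rbrakk> \<Longrightarrow> P (pure_tensor K M N x y)"
    and add: "\<And>s t. \<lbrakk>s \<in> carrier (M \<boxtimes>\<^bsub>K\<^esub> N); t \<in> carrier (M \<boxtimes>\<^bsub>K\<^esub> N); P s; P t\<rbrakk>
        \<Longrightarrow> P (s \<oplus>\<^bsub>M \<boxtimes>\<^bsub>K\<^esub> N\<^esub> t)"
  shows "P t"
proof -
  interpret M: module K M by fact
  interpret N: module K N by fact
  interpret T: module K "M \<boxtimes>\<^bsub>K\<^esub> N" by (rule tensor_module) fact+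
  let ?F = "free_module K (carrier M \<times> carrier N)"
  let ?H = "tensor_null K M N"
  have F: "module K ?F" by (rule free_module_module) (rule M.R.is_cring)
  have H: "submodule ?H K ?F" by (rule tensor_null_submodule) fact+
  note coset = coset_linear[OF F H, folded tensor_def]
  obtain h where h: "h \<in> carrier ?F" "t = ?H +>\<^bsub>?F\<^esub> h"
    using t unfolding tensor_def by (rule quot_module_cosetE)
  have "P (?H +>\<^bsub>?F\<^esub> h)"
    using M.R.is_cring h(1)
  proof (induction rule: free_module_induct)
    case zero
    have "?H +>\<^bsub>?F\<^esub> \<zero>\<^bsub>?F\<^esub> = \<zero>\<^bsub>M \<boxtimes>\<^bsub>K\<^esub> N\<^esub>"
      by (rule linear_maps_zero[OF F T.module_axioms coset])
    also have "\<dots> = pure_tensor K M N \<zero>\<^bsub>M\<^esub> \<zero>\<^bsub>N\<^esub>"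
      by (rule linear_maps_zero[OF N.module_axioms T.module_axioms, symmetric],
          rule bilinear_maps_right[OF pure_tensor_bilinear])
        (simp_all add: M.module_axioms N.module_axioms)
    finally show ?case by (simp add: pure)
  next
    case (gen c s)
    obtain x y where s: "s = (x, y)" "x \<in> carrier M" "y \<in> carrier N" using gen by auto
    have "?H +>\<^bsub>?F\<^esub> (c \<odot>\<^bsub>?F\<^esub> free_gen K s) = c \<odot>\<^bsub>M \<boxtimes>\<^bsub>K\<^esub> N\<^esub> pure_tensor K M N x y"
      using gen s
      by (simp add: linear_maps_smult[OF coset] free_gen_closed M.R.is_cring pure_tensor_def)
    also have "\<dots> = pure_tensor K M N x (c \<odot>\<^bsub>N\<^esub> y)"
      using gen s assms(1,2)
      by (simp add: linear_maps_smult[OF bilinear_maps_right[OF pure_tensor_bilinear]])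
    finally show ?case using gen s by (simp add: pure)
  next
    case (add f g)
    then show ?case
      by (simp add: linear_maps_add[OF coset] assms(5) linear_maps_closed[OF coset])
  qed
  with h show ?thesis by simp
qed

text \<open>Well-definedness of \<open>tensor_lift\<close>: the linear extension of a bilinear map to formal combinations
  kills each bilinearity relation, hence the submodule that they span, and is thus constant on
  cosets.\<close>

lemma tensor_lift_coset:
  assumes "module K M" "module K N" "module K P" and f: "f \<in> bilinear_maps K M N P"
    and h: "h \<in> carrier (free_module K (carrier M \<times> carrier N))"
  shows "tensor_lift K P f (tensor_null K M N +>\<^bsub>free_module K (carrier M \<times> carrier N)\<^esub> h)
       = free_lift K P (\<lambda>s. f (fst s) (snd s)) h"
proof -
  interpret M: module K M by fact
  interpret N: module K N by fact
  interpret P: module K P by fact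
  let ?F = "free_module K (carrier M \<times> carrier N)"
  let ?H = "tensor_null K M N"
  let ?ev = "free_lift K P (\<lambda>s. f (fst s) (snd s))"
  have F: "module K ?F" by (rule free_module_module) (rule M.R.is_cring)
  interpret F: module K ?F by (rule F)
  interpret H: abelian_subgroup ?H ?F
    by (rule submodule_abelian_subgroup[OF F tensor_null_submodule[OF assms(1,2)]])
  have fc: "f x y \<in> carrier P" if "x \<in> carrier M" "y \<in> carrier N" for x y
    using bilinear_maps_closed[OF f that] .
  have ev: "?ev \<in> linear_maps K ?F P"
    using fc by (intro free_lift_linear assms) auto
  note gen = free_gen_closed[OF M.R.is_cring]
  have ev_gen: "?ev (free_gen K (x, y)) = f x y" if "x \<in> carrier M" "y \<in> carrier N" for x y
    using fc[OF that] by (simp add: free_lift_gen assms)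
  let ?Z = "{h \<in> carrier ?F. ?ev h = \<zero>\<^bsub>P\<^esub>}"
  have rel: "g \<ominus>\<^bsub>?F\<^esub> g' \<in> ?Z"
    if "g \<in> carrier ?F" "g' \<in> carrier ?F" "?ev g = ?ev g'" for g g'
    using that linear_maps_closed[OF ev]
    by (simp add: linear_maps_minus[OF F assms(3) ev] a_minus_def[of P] P.r_neg)
  note l = bilinear_maps_left[OF f] and r = bilinear_maps_right[OF f]
  have "bilinear_relations K M N \<subseteq> ?Z"
    unfolding bilinear_relations_def Let_def
    by (intro Un_least subsetI; elim CollectE exE conjE; hypsubst; rule rel)
      (auto simp: gen ev_gen linear_maps_add[OF ev] linear_maps_smult[OF ev]
        linear_maps_add[OF l] linear_maps_smult[OF l] linear_maps_add[OF r] linear_maps_smult[OF r])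
  then have HZ: "?H \<subseteq> ?Z"
    unfolding tensor_null_def
    by (intro submodule_span_least submodule_kernel F assms ev)
  have const: "?ev g = ?ev h" if "g \<in> ?H +>\<^bsub>?F\<^esub> h" for g
  proof -
    obtain z where "z \<in> ?H" "g = z \<oplus>\<^bsub>?F\<^esub> h" using \<open>g \<in> ?H +>\<^bsub>?F\<^esub> h\<close> by (auto simp: a_r_coset_def')
    with HZ h show ?thesis by (auto simp: linear_maps_add[OF ev] linear_maps_closed[OF ev])
  qed
  have "h \<in> ?H +>\<^bsub>?F\<^esub> h" using h H.a_rcos_self by blast
  with const have "?ev ` (?H +>\<^bsub>?F\<^esub> h) = {?ev h}" by blast
  then show ?thesis by (simp add: tensor_lift_def free_lift_def)
qed

lemma tensor_lift_linear:
  assumes "module K M" "module K N" "module K P" and f: "f \<in> bilinear_maps K M N P"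
  shows "tensor_lift K P f \<in> linear_maps K (M \<boxtimes>\<^bsub>K\<^esub> N) P"
proof -
  let ?F = "free_module K (carrier M \<times> carrier N)"
  let ?H = "tensor_null K M N"
  have F: "module K ?F" using assms(1) by (intro free_module_module) (simp add: module_def)
  have H: "submodule ?H K ?F" by (rule tensor_null_submodule) fact+
  note coset = coset_linear[OF F H, folded tensor_def]
  have ev: "free_lift K P (\<lambda>s. f (fst s) (snd s)) \<in> linear_maps K ?F P"
    using bilinear_maps_closed[OF f] by (intro free_lift_linear assms) auto
  note [simp] = tensor_lift_coset[OF assms] linear_maps_closed[OF ev] linear_maps_add[OF ev]
    linear_maps_smult[OF ev] linear_maps_add[OF coset, symmetric]
    linear_maps_smult[OF coset, symmetric]
  interpret F: module K ?F by (rule F)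
  have cE: thesis if "t \<in> carrier (M \<boxtimes>\<^bsub>K\<^esub> N)"
    "\<And>x. \<lbrakk>x \<in> carrier ?F; t = ?H +>\<^bsub>?F\<^esub> x\<rbrakk> \<Longrightarrow> thesis" for t thesis
    using that unfolding tensor_def by (blast elim: quot_module_cosetE)
  show ?thesis
    by (rule linear_mapsI) (auto elim!: cE)
qed

lemma tensor_lift_pure:
  assumes "module K M" "module K N" "module K P" and f: "f \<in> bilinear_maps K M N P"
    and "x \<in> carrier M" "y \<in> carrier N"
  shows "tensor_lift K P f (pure_tensor K M N x y) = f x y"
proof -
  have "cring K" using assms(1) by (simp add: module_def)
  then show ?thesis
    unfolding pure_tensor_def using assms bilinear_maps_closed[OF f]
    by (simp add: tensor_lift_coset free_gen_closed free_lift_gen)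
qed


section \<open>Tensor products of linear maps and reassociation\<close>

lemma tensor_map_bilinear:
  assumes "module K M'" "module K N'" "f \<in> linear_maps K M M'" "g \<in> linear_maps K N N'"
  shows "(\<lambda>x y. pure_tensor K M' N' (f x) (g y)) \<in> bilinear_maps K M N (M' \<boxtimes>\<^bsub>K\<^esub> N')"
  by (rule bilinear_maps_comp[OF pure_tensor_bilinear assms(3,4)]) fact+

lemma tensor_map_linear:
  assumes "module K M" "module K N" "module K M'" "module K N'"
    and "f \<in> linear_maps K M M'" "g \<in> linear_maps K N N'"
  shows "tensor_map K M' N' f g \<in> linear_maps K (M \<boxtimes>\<^bsub>K\<^esub> N) (M' \<boxtimes>\<^bsub>K\<^esub> N')"
  unfolding tensor_map_def
  by (intro tensor_lift_linear tensor_map_bilinear tensor_module assms)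

lemma tensor_map_pure:
  assumes "module K M" "module K N" "module K M'" "module K N'"
    and "f \<in> linear_maps K M M'" "g \<in> linear_maps K N N'" "x \<in> carrier M" "y \<in> carrier N"
  shows "tensor_map K M' N' f g (pure_tensor K M N x y) = pure_tensor K M' N' (f x) (g y)"
  unfolding tensor_map_def
  by (intro tensor_lift_pure tensor_map_bilinear tensor_module assms)

text \<open>The maps that both reassociations lift are themselves lifts depending on a parameter, so their
  linearity in the parameter has to be traced back to pure tensors.\<close>

lemma tensor_lift_bilinear:
  assumes mods: "module K M" "module K N" "module K P" "module K Q"
    and f: "\<And>z. z \<in> carrier P \<Longrightarrow> f z \<in> bilinear_maps K M N Q"
    and fz: "\<And>x y. \<lbrakk>x \<in> carrier M; y \<in> carrier N\<rbrakk> \<Longrightarrow> (\<lambda>z. f z x y) \<in> linear_maps K P Q"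
  shows "(\<lambda>t z. tensor_lift K Q (f z) t) \<in> bilinear_maps K (M \<boxtimes>\<^bsub>K\<^esub> N) P Q"
proof (rule bilinear_mapsI)
  interpret P: module K P by fact
  interpret Q: module K Q by fact
  interpret T: module K "M \<boxtimes>\<^bsub>K\<^esub> N" by (intro tensor_module mods)
  have lin: "tensor_lift K Q (f z) \<in> linear_maps K (M \<boxtimes>\<^bsub>K\<^esub> N) Q" if "z \<in> carrier P" for z
    by (intro tensor_lift_linear mods f that)
  then show "(\<lambda>t. tensor_lift K Q (f z) t) \<in> linear_maps K (M \<boxtimes>\<^bsub>K\<^esub> N) Q" if "z \<in> carrier P" for z
    using that .
  fix t assume "t \<in> carrier (M \<boxtimes>\<^bsub>K\<^esub> N)"
  with mods(1,2) show "(\<lambda>z. tensor_lift K Q (f z) t) \<in> linear_maps K P Q"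
  proof (induction rule: tensor_induct)
    case (pure x y)
    have [simp]: "tensor_lift K Q (f z) (pure_tensor K M N x y) = f z x y" if "z \<in> carrier P" for z
      by (intro tensor_lift_pure mods f that pure)
    show ?case
      by (rule linear_mapsI) (simp_all add: linear_maps_rules[OF fz[OF pure]])
  next
    case (add s t)
    have [simp]: "tensor_lift K Q (f z) (s \<oplus>\<^bsub>M \<boxtimes>\<^bsub>K\<^esub> N\<^esub> t)
        = tensor_lift K Q (f z) s \<oplus>\<^bsub>Q\<^esub> tensor_lift K Q (f z) t" if "z \<in> carrier P" for z
      by (rule linear_maps_add[OF lin]) (use that add in auto)
    note rules = linear_maps_rules[OF add.IH(1)] linear_maps_rules[OF add.IH(2)]
    show ?case
      by (rule linear_mapsI) (simp_all add: rules Q.smult_r_distr Q.add.m_ac)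
  qed
qed

lemma bilinear_maps_flip: "f \<in> bilinear_maps K M N P \<Longrightarrow> (\<lambda>y x. f x y) \<in> bilinear_maps K N M P"
  by (auto simp: bilinear_maps_def)

lemma reassoc_right_bilinear:
  assumes mods: "module K M" "module K N" "module K P"
  shows "(\<lambda>t z. tensor_lift K (M \<boxtimes>\<^bsub>K\<^esub> (N \<boxtimes>\<^bsub>K\<^esub> P))
        (\<lambda>x y. pure_tensor K M (N \<boxtimes>\<^bsub>K\<^esub> P) x (pure_tensor K N P y z)) t)
      \<in> bilinear_maps K (M \<boxtimes>\<^bsub>K\<^esub> N) P (M \<boxtimes>\<^bsub>K\<^esub> (N \<boxtimes>\<^bsub>K\<^esub> P))"
proof (rule tensor_lift_bilinear)
  note outer = pure_tensor_bilinear[OF mods(1) tensor_module[OF mods(2,3)]]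
  note inner = pure_tensor_bilinear[OF mods(2,3)]
  show "(\<lambda>x y. pure_tensor K M (N \<boxtimes>\<^bsub>K\<^esub> P) x (pure_tensor K N P y z))
      \<in> bilinear_maps K M N (M \<boxtimes>\<^bsub>K\<^esub> (N \<boxtimes>\<^bsub>K\<^esub> P))" if "z \<in> carrier P" for z
    using bilinear_maps_comp[OF outer linear_maps_id bilinear_maps_left[OF inner that]] by simp
  show "(\<lambda>z. pure_tensor K M (N \<boxtimes>\<^bsub>K\<^esub> P) x (pure_tensor K N P y z))
      \<in> linear_maps K P (M \<boxtimes>\<^bsub>K\<^esub> (N \<boxtimes>\<^bsub>K\<^esub> P))" if "x \<in> carrier M" "y \<in> carrier N" for x y
    using linear_maps_comp[OF bilinear_maps_right[OF outer that(1)] bilinear_maps_right[OF inner that(2)]]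
    by (simp add: comp_def)
qed (intro tensor_module mods)+

lemma reassoc_right_linear:
  assumes "module K M" "module K N" "module K P"
  shows "reassoc_right K M N P
    \<in> linear_maps K ((M \<boxtimes>\<^bsub>K\<^esub> N) \<boxtimes>\<^bsub>K\<^esub> P) (M \<boxtimes>\<^bsub>K\<^esub> (N \<boxtimes>\<^bsub>K\<^esub> P))"
  unfolding reassoc_right_def
  by (intro tensor_lift_linear reassoc_right_bilinear tensor_module assms)

lemma reassoc_right_pure:
  assumes mods: "module K M" "module K N" "module K P"
    and xyz: "x \<in> carrier M" "y \<in> carrier N" "z \<in> carrier P"
  shows "reassoc_right K M N P (pure_tensor K (M \<boxtimes>\<^bsub>K\<^esub> N) P (pure_tensor K M N x y) z)
    = pure_tensor K M (N \<boxtimes>\<^bsub>K\<^esub> P) x (pure_tensor K N P y z)"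
proof -
  note outer = pure_tensor_bilinear[OF mods(1) tensor_module[OF mods(2,3)]]
  note inner = pure_tensor_bilinear[OF mods(2,3)]
  have b: "(\<lambda>x y. pure_tensor K M (N \<boxtimes>\<^bsub>K\<^esub> P) x (pure_tensor K N P y z))
      \<in> bilinear_maps K M N (M \<boxtimes>\<^bsub>K\<^esub> (N \<boxtimes>\<^bsub>K\<^esub> P))"
    using bilinear_maps_comp[OF outer linear_maps_id bilinear_maps_left[OF inner xyz(3)]] by simp
  show ?thesis
    unfolding reassoc_right_def
    by (subst tensor_lift_pure[OF tensor_module[OF mods(1,2)] mods(3) _ reassoc_right_bilinear[OF mods]],
        (intro tensor_module pure_tensor_closed mods xyz)+)
      (rule tensor_lift_pure[OF mods(1,2) _ b xyz(1,2)], intro tensor_module mods)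
qed

lemma reassoc_left_bilinear:
  assumes mods: "module K M" "module K N" "module K P"
  shows "(\<lambda>x t. tensor_lift K ((M \<boxtimes>\<^bsub>K\<^esub> N) \<boxtimes>\<^bsub>K\<^esub> P)
        (\<lambda>y z. pure_tensor K (M \<boxtimes>\<^bsub>K\<^esub> N) P (pure_tensor K M N x y) z) t)
      \<in> bilinear_maps K M (N \<boxtimes>\<^bsub>K\<^esub> P) ((M \<boxtimes>\<^bsub>K\<^esub> N) \<boxtimes>\<^bsub>K\<^esub> P)"
proof (rule bilinear_maps_flip, rule tensor_lift_bilinear)
  note outer = pure_tensor_bilinear[OF tensor_module[OF mods(1,2)] mods(3)]
  note inner = pure_tensor_bilinear[OF mods(1,2)]
  show "(\<lambda>y z. pure_tensor K (M \<boxtimes>\<^bsub>K\<^esub> N) P (pure_tensor K M N x y) z)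
      \<in> bilinear_maps K N P ((M \<boxtimes>\<^bsub>K\<^esub> N) \<boxtimes>\<^bsub>K\<^esub> P)" if "x \<in> carrier M" for x
    using bilinear_maps_comp[OF outer bilinear_maps_right[OF inner that] linear_maps_id] by simp
  show "(\<lambda>x. pure_tensor K (M \<boxtimes>\<^bsub>K\<^esub> N) P (pure_tensor K M N x y) z)
      \<in> linear_maps K M ((M \<boxtimes>\<^bsub>K\<^esub> N) \<boxtimes>\<^bsub>K\<^esub> P)" if "y \<in> carrier N" "z \<in> carrier P" for y z
    using linear_maps_comp[OF bilinear_maps_left[OF outer that(2)] bilinear_maps_left[OF inner that(1)]]
    by (simp add: comp_def)
qed (intro tensor_module mods)+

lemma reassoc_left_linear:
  assumes "module K M" "module K N" "module K P"
  shows "reassoc_left K M N P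
    \<in> linear_maps K (M \<boxtimes>\<^bsub>K\<^esub> (N \<boxtimes>\<^bsub>K\<^esub> P)) ((M \<boxtimes>\<^bsub>K\<^esub> N) \<boxtimes>\<^bsub>K\<^esub> P)"
  unfolding reassoc_left_def
  by (intro tensor_lift_linear reassoc_left_bilinear tensor_module assms)

lemma reassoc_left_pure:
  assumes mods: "module K M" "module K N" "module K P"
    and xyz: "x \<in> carrier M" "y \<in> carrier N" "z \<in> carrier P"
  shows "reassoc_left K M N P (pure_tensor K M (N \<boxtimes>\<^bsub>K\<^esub> P) x (pure_tensor K N P y z))
    = pure_tensor K (M \<boxtimes>\<^bsub>K\<^esub> N) P (pure_tensor K M N x y) z"
proof -
  note outer = pure_tensor_bilinear[OF tensor_module[OF mods(1,2)] mods(3)]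
  note inner = pure_tensor_bilinear[OF mods(1,2)]
  have b: "(\<lambda>y z. pure_tensor K (M \<boxtimes>\<^bsub>K\<^esub> N) P (pure_tensor K M N x y) z)
      \<in> bilinear_maps K N P ((M \<boxtimes>\<^bsub>K\<^esub> N) \<boxtimes>\<^bsub>K\<^esub> P)"
    using bilinear_maps_comp[OF outer bilinear_maps_right[OF inner xyz(1)] linear_maps_id] by simp
  show ?thesis
    unfolding reassoc_left_def
    by (subst tensor_lift_pure[OF mods(1) tensor_module[OF mods(2,3)] _ reassoc_left_bilinear[OF mods]],
        (intro tensor_module pure_tensor_closed mods xyz)+)
      (rule tensor_lift_pure[OF mods(2,3) _ b xyz(2,3)], intro tensor_module mods)
qed


section \<open>The twisted multiplication\<close>

lemma unital_algebra_module: "unital_algebra K A \<Longrightarrow> module K A"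
  by (simp add: unital_algebra_def)

lemma mult_bilinear:
  assumes "unital_algebra K A"
  shows "(\<lambda>x y. x \<otimes>\<^bsub>A\<^esub> y) \<in> bilinear_maps K A A A"
proof -
  interpret A: unital_algebra K A by fact
  show ?thesis
    by (intro bilinear_mapsI linear_mapsI)
      (auto simp: A.r_distr A.l_distr A.smult_mult_left A.smult_mult_right)
qed

lemma mult_map_linear:
  assumes "unital_algebra K A"
  shows "mult_map K A \<in> linear_maps K (A \<boxtimes>\<^bsub>K\<^esub> A) A"
  unfolding mult_map_def
  by (intro tensor_lift_linear mult_bilinear unital_algebra_module assms)

lemma mult_map_pure:
  assumes "unital_algebra K A" "x \<in> carrier A" "y \<in> carrier A"
  shows "mult_map K A (pure_tensor K A A x y) = x \<otimes>\<^bsub>A\<^esub> y"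
  unfolding mult_map_def
  by (intro tensor_lift_pure mult_bilinear unital_algebra_module assms)

text \<open>The part of \<open>m\<^sub>\<psi>\<close> that follows \<open>\<psi>\<close>: it multiplies \<open>a \<otimes> (t \<otimes> b')\<close> out to \<open>a t b'\<close>.\<close>

lemma mult_outer_factors_linear:
  assumes A: "unital_algebra K A" and B: "unital_algebra K B"
  shows "tensor_map K A B (mult_map K A) (mult_map K B)
      \<circ> reassoc_left K A A (B \<boxtimes>\<^bsub>K\<^esub> B)
      \<circ> tensor_map K A (A \<boxtimes>\<^bsub>K\<^esub> (B \<boxtimes>\<^bsub>K\<^esub> B)) id (reassoc_right K A B B)
    \<in> linear_maps K (A \<boxtimes>\<^bsub>K\<^esub> ((A \<boxtimes>\<^bsub>K\<^esub> B) \<boxtimes>\<^bsub>K\<^esub> B)) (A \<boxtimes>\<^bsub>K\<^esub> B)"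
proof (intro linear_maps_comp)
  note mods = tensor_module unital_algebra_module A B
  show "tensor_map K A (A \<boxtimes>\<^bsub>K\<^esub> (B \<boxtimes>\<^bsub>K\<^esub> B)) id (reassoc_right K A B B)
      \<in> linear_maps K (A \<boxtimes>\<^bsub>K\<^esub> ((A \<boxtimes>\<^bsub>K\<^esub> B) \<boxtimes>\<^bsub>K\<^esub> B)) (A \<boxtimes>\<^bsub>K\<^esub> (A \<boxtimes>\<^bsub>K\<^esub> (B \<boxtimes>\<^bsub>K\<^esub> B)))"
    by (intro tensor_map_linear linear_maps_id reassoc_right_linear mods)
  show "reassoc_left K A A (B \<boxtimes>\<^bsub>K\<^esub> B)
      \<in> linear_maps K (A \<boxtimes>\<^bsub>K\<^esub> (A \<boxtimes>\<^bsub>K\<^esub> (B \<boxtimes>\<^bsub>K\<^esub> B))) ((A \<boxtimes>\<^bsub>K\<^esub> A) \<boxtimes>\<^bsub>K\<^esub> (B \<boxtimes>\<^bsub>K\<^esub> B))"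
    by (intro reassoc_left_linear mods)
  show "tensor_map K A B (mult_map K A) (mult_map K B)
      \<in> linear_maps K ((A \<boxtimes>\<^bsub>K\<^esub> A) \<boxtimes>\<^bsub>K\<^esub> (B \<boxtimes>\<^bsub>K\<^esub> B)) (A \<boxtimes>\<^bsub>K\<^esub> B)"
    by (intro tensor_map_linear mult_map_linear mods)
qed

lemma twisted_mult_linear:
  assumes A: "unital_algebra K A" and B: "unital_algebra K B"
    and \<psi>: "\<psi> \<in> linear_maps K (B \<boxtimes>\<^bsub>K\<^esub> A) (A \<boxtimes>\<^bsub>K\<^esub> B)"
  shows "twisted_mult K A B \<psi>
    \<in> linear_maps K ((A \<boxtimes>\<^bsub>K\<^esub> B) \<boxtimes>\<^bsub>K\<^esub> (A \<boxtimes>\<^bsub>K\<^esub> B)) (A \<boxtimes>\<^bsub>K\<^esub> B)"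
  unfolding twisted_mult_def
proof (rule linear_maps_comp[OF linear_maps_comp[OF linear_maps_comp[OF mult_outer_factors_linear[OF A B]]]])
  note mods = tensor_module unital_algebra_module A B
  show "reassoc_right K A B (A \<boxtimes>\<^bsub>K\<^esub> B)
      \<in> linear_maps K ((A \<boxtimes>\<^bsub>K\<^esub> B) \<boxtimes>\<^bsub>K\<^esub> (A \<boxtimes>\<^bsub>K\<^esub> B)) (A \<boxtimes>\<^bsub>K\<^esub> (B \<boxtimes>\<^bsub>K\<^esub> (A \<boxtimes>\<^bsub>K\<^esub> B)))"
    by (intro reassoc_right_linear mods)
  show "tensor_map K A ((B \<boxtimes>\<^bsub>K\<^esub> A) \<boxtimes>\<^bsub>K\<^esub> B) id (reassoc_left K B A B)
      \<in> linear_maps K (A \<boxtimes>\<^bsub>K\<^esub> (B \<boxtimes>\<^bsub>K\<^esub> (A \<boxtimes>\<^bsub>K\<^esub> B))) (A \<boxtimes>\<^bsub>K\<^esub> ((B \<boxtimes>\<^bsub>K\<^esub> A) \<boxtimes>\<^bsub>K\<^esub> B))"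
    by (intro tensor_map_linear linear_maps_id reassoc_left_linear mods)
  show "tensor_map K A ((A \<boxtimes>\<^bsub>K\<^esub> B) \<boxtimes>\<^bsub>K\<^esub> B) id (tensor_map K (A \<boxtimes>\<^bsub>K\<^esub> B) B \<psi> id)
      \<in> linear_maps K (A \<boxtimes>\<^bsub>K\<^esub> ((B \<boxtimes>\<^bsub>K\<^esub> A) \<boxtimes>\<^bsub>K\<^esub> B)) (A \<boxtimes>\<^bsub>K\<^esub> ((A \<boxtimes>\<^bsub>K\<^esub> B) \<boxtimes>\<^bsub>K\<^esub> B))"
    by (intro tensor_map_linear linear_maps_id mods \<psi>)
qed

text \<open>In short, \<open>(a \<otimes> b)(a' \<otimes> b') = a \<psi>(b \<otimes> a') b'\<close>. The value of \<open>\<psi>\<close> is in general not a pure tensor,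
  so the reassociations after it cannot be evaluated directly; but both sides are additive in
  this value, which may therefore be replaced by a pure tensor.\<close>

lemma twisted_mult_pure:
  assumes A: "unital_algebra K A" and B: "unital_algebra K B"
    and \<psi>: "\<psi> \<in> linear_maps K (B \<boxtimes>\<^bsub>K\<^esub> A) (A \<boxtimes>\<^bsub>K\<^esub> B)"
    and a: "a \<in> carrier A" and b: "b \<in> carrier B" and a': "a' \<in> carrier A" and b': "b' \<in> carrier B"
  shows "twisted_mult K A B \<psi>
      (pure_tensor K (A \<boxtimes>\<^bsub>K\<^esub> B) (A \<boxtimes>\<^bsub>K\<^esub> B) (pure_tensor K A B a b) (pure_tensor K A B a' b'))
    = tensor_map K A B (\<lambda>x. a \<otimes>\<^bsub>A\<^esub> x) (\<lambda>y. y \<otimes>\<^bsub>B\<^esub> b') (\<psi> (pure_tensor K B A b a'))"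
proof -
  note mods = tensor_module unital_algebra_module A B
  note lin = tensor_map_linear reassoc_left_linear reassoc_right_linear mult_map_linear
    linear_maps_id bilinear_maps_left[OF mult_bilinear] bilinear_maps_right[OF mult_bilinear]
  define G where "G = tensor_map K A B (mult_map K A) (mult_map K B)
    \<circ> reassoc_left K A A (B \<boxtimes>\<^bsub>K\<^esub> B)
    \<circ> tensor_map K A (A \<boxtimes>\<^bsub>K\<^esub> (B \<boxtimes>\<^bsub>K\<^esub> B)) id (reassoc_right K A B B)"
  have G: "G \<in> linear_maps K (A \<boxtimes>\<^bsub>K\<^esub> ((A \<boxtimes>\<^bsub>K\<^esub> B) \<boxtimes>\<^bsub>K\<^esub> B)) (A \<boxtimes>\<^bsub>K\<^esub> B)"
    unfolding G_def by (rule mult_outer_factors_linear[OF A B])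
  have F: "(\<lambda>t. pure_tensor K A ((A \<boxtimes>\<^bsub>K\<^esub> B) \<boxtimes>\<^bsub>K\<^esub> B) a (pure_tensor K (A \<boxtimes>\<^bsub>K\<^esub> B) B t b'))
      \<in> linear_maps K (A \<boxtimes>\<^bsub>K\<^esub> B) (A \<boxtimes>\<^bsub>K\<^esub> ((A \<boxtimes>\<^bsub>K\<^esub> B) \<boxtimes>\<^bsub>K\<^esub> B))"
    by (rule linear_maps_comp[unfolded comp_def,
        OF bilinear_maps_right[OF pure_tensor_bilinear a]
           bilinear_maps_left[OF pure_tensor_bilinear b']]) (intro mods)+
  note GF = linear_maps_comp[OF G F, unfolded comp_def]
  have R: "tensor_map K A B (\<lambda>x. a \<otimes>\<^bsub>A\<^esub> x) (\<lambda>y. y \<otimes>\<^bsub>B\<^esub> b') \<in> linear_maps K (A \<boxtimes>\<^bsub>K\<^esub> B) (A \<boxtimes>\<^bsub>K\<^esub> B)"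
    by (intro lin mods a b')
  have multiply: "G (pure_tensor K A ((A \<boxtimes>\<^bsub>K\<^esub> B) \<boxtimes>\<^bsub>K\<^esub> B) a (pure_tensor K (A \<boxtimes>\<^bsub>K\<^esub> B) B t b'))
      = tensor_map K A B (\<lambda>x. a \<otimes>\<^bsub>A\<^esub> x) (\<lambda>y. y \<otimes>\<^bsub>B\<^esub> b') t"
    if "t \<in> carrier (A \<boxtimes>\<^bsub>K\<^esub> B)" for t
    using unital_algebra_module[OF A] unital_algebra_module[OF B] that
  proof (induction rule: tensor_induct)
    case (pure x y)
    have 1: "tensor_map K A (A \<boxtimes>\<^bsub>K\<^esub> (B \<boxtimes>\<^bsub>K\<^esub> B)) id (reassoc_right K A B B)
          (pure_tensor K A ((A \<boxtimes>\<^bsub>K\<^esub> B) \<boxtimes>\<^bsub>K\<^esub> B) a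
            (pure_tensor K (A \<boxtimes>\<^bsub>K\<^esub> B) B (pure_tensor K A B x y) b'))
        = pure_tensor K A (A \<boxtimes>\<^bsub>K\<^esub> (B \<boxtimes>\<^bsub>K\<^esub> B)) a
            (pure_tensor K A (B \<boxtimes>\<^bsub>K\<^esub> B) x (pure_tensor K B B y b'))"
      by (subst tensor_map_pure, (intro lin mods pure_tensor_closed a b' pure)+)
        (subst reassoc_right_pure, (intro mods pure b')+, simp)
    have 2: "reassoc_left K A A (B \<boxtimes>\<^bsub>K\<^esub> B)
          (pure_tensor K A (A \<boxtimes>\<^bsub>K\<^esub> (B \<boxtimes>\<^bsub>K\<^esub> B)) a
            (pure_tensor K A (B \<boxtimes>\<^bsub>K\<^esub> B) x (pure_tensor K B B y b')))
        = pure_tensor K (A \<boxtimes>\<^bsub>K\<^esub> A) (B \<boxtimes>\<^bsub>K\<^esub> B) (pure_tensor K A A a x) (pure_tensor K B B y b')"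
      by (intro reassoc_left_pure mods pure_tensor_closed a b' pure)
    have 3: "tensor_map K A B (mult_map K A) (mult_map K B)
          (pure_tensor K (A \<boxtimes>\<^bsub>K\<^esub> A) (B \<boxtimes>\<^bsub>K\<^esub> B) (pure_tensor K A A a x) (pure_tensor K B B y b'))
        = pure_tensor K A B (a \<otimes>\<^bsub>A\<^esub> x) (y \<otimes>\<^bsub>B\<^esub> b')"
      by (subst tensor_map_pure, (intro lin mods pure_tensor_closed a b' pure)+)
        (simp add: mult_map_pure A B a b' pure)
    have 4: "tensor_map K A B (\<lambda>x. a \<otimes>\<^bsub>A\<^esub> x) (\<lambda>y. y \<otimes>\<^bsub>B\<^esub> b') (pure_tensor K A B x y)
        = pure_tensor K A B (a \<otimes>\<^bsub>A\<^esub> x) (y \<otimes>\<^bsub>B\<^esub> b')"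
      by (rule tensor_map_pure) (intro lin mods a b' pure)+
    show ?case by (simp add: G_def 1 2 3 4)
  next
    case (add s t)
    then show ?case by (simp add: linear_maps_add[OF GF] linear_maps_add[OF R])
  qed
  have 1: "reassoc_right K A B (A \<boxtimes>\<^bsub>K\<^esub> B)
        (pure_tensor K (A \<boxtimes>\<^bsub>K\<^esub> B) (A \<boxtimes>\<^bsub>K\<^esub> B) (pure_tensor K A B a b) (pure_tensor K A B a' b'))
      = pure_tensor K A (B \<boxtimes>\<^bsub>K\<^esub> (A \<boxtimes>\<^bsub>K\<^esub> B)) a
          (pure_tensor K B (A \<boxtimes>\<^bsub>K\<^esub> B) b (pure_tensor K A B a' b'))"
    by (intro reassoc_right_pure mods pure_tensor_closed a b a' b')
  have 2: "tensor_map K A ((B \<boxtimes>\<^bsub>K\<^esub> A) \<boxtimes>\<^bsub>K\<^esub> B) id (reassoc_left K B A B)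
        (pure_tensor K A (B \<boxtimes>\<^bsub>K\<^esub> (A \<boxtimes>\<^bsub>K\<^esub> B)) a
          (pure_tensor K B (A \<boxtimes>\<^bsub>K\<^esub> B) b (pure_tensor K A B a' b')))
      = pure_tensor K A ((B \<boxtimes>\<^bsub>K\<^esub> A) \<boxtimes>\<^bsub>K\<^esub> B) a
          (pure_tensor K (B \<boxtimes>\<^bsub>K\<^esub> A) B (pure_tensor K B A b a') b')"
    by (subst tensor_map_pure, (intro lin mods pure_tensor_closed a b a' b')+)
      (subst reassoc_left_pure, (intro mods a b a' b')+, simp)
  have 3: "tensor_map K A ((A \<boxtimes>\<^bsub>K\<^esub> B) \<boxtimes>\<^bsub>K\<^esub> B) id (tensor_map K (A \<boxtimes>\<^bsub>K\<^esub> B) B \<psi> id)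
        (pure_tensor K A ((B \<boxtimes>\<^bsub>K\<^esub> A) \<boxtimes>\<^bsub>K\<^esub> B) a
          (pure_tensor K (B \<boxtimes>\<^bsub>K\<^esub> A) B (pure_tensor K B A b a') b'))
      = pure_tensor K A ((A \<boxtimes>\<^bsub>K\<^esub> B) \<boxtimes>\<^bsub>K\<^esub> B) a
          (pure_tensor K (A \<boxtimes>\<^bsub>K\<^esub> B) B (\<psi> (pure_tensor K B A b a')) b')"
    by (subst tensor_map_pure, (intro lin mods pure_tensor_closed \<psi> a b a' b')+)
      (subst tensor_map_pure, (intro lin mods pure_tensor_closed \<psi> a b a' b')+, simp)
  have "\<psi> (pure_tensor K B A b a') \<in> carrier (A \<boxtimes>\<^bsub>K\<^esub> B)"
    by (intro linear_maps_closed[OF \<psi>] pure_tensor_closed mods a' b)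
  from multiply[OF this] show ?thesis
    by (simp add: twisted_mult_def 1 2 3 G_def)
qed


section \<open>The universal property\<close>

text \<open>The map \<open>m\<^sub>X (f \<otimes> g)\<close>, which for \<open>f = j\<^sub>A\<close> and \<open>g = j\<^sub>B\<close> is the required morphism \<open>\<omega>\<close>.\<close>

definition mult_lift ::
    "('k, 'r) ring_scheme \<Rightarrow> ('k, 'x, 'p) module_scheme \<Rightarrow> ('a \<Rightarrow> 'x) \<Rightarrow> ('b \<Rightarrow> 'x)
      \<Rightarrow> ('a \<times> 'b \<Rightarrow> 'k) set \<Rightarrow> 'x"
  where "mult_lift K X f g = mult_map K X \<circ> tensor_map K X X f g"

lemma mult_lift_linear:
  assumes "module K M" "module K N" "unital_algebra K X"
    and "f \<in> linear_maps K M X" "g \<in> linear_maps K N X"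
  shows "mult_lift K X f g \<in> linear_maps K (M \<boxtimes>\<^bsub>K\<^esub> N) X"
  unfolding mult_lift_def
  by (rule linear_maps_comp[OF mult_map_linear tensor_map_linear])
    (intro assms unital_algebra_module)+

lemma mult_lift_pure:
  assumes "module K M" "module K N" "unital_algebra K X"
    and "f \<in> linear_maps K M X" "g \<in> linear_maps K N X" "x \<in> carrier M" "y \<in> carrier N"
  shows "mult_lift K X f g (pure_tensor K M N x y) = f x \<otimes>\<^bsub>X\<^esub> g y"
  unfolding mult_lift_def comp_def
  by (subst tensor_map_pure, (intro assms unital_algebra_module)+)
    (intro mult_map_pure assms linear_maps_closed[OF assms(4)] linear_maps_closed[OF assms(5)])

text \<open>If \<open>f\<close> turns \<open>L\<close> into left multiplication by \<open>u\<close>, and \<open>g\<close> turns \<open>R\<close> into right multiplication by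
  \<open>v\<close>, then \<open>m (f \<otimes> g) (L \<otimes> R) t = u \<cdot> m (f \<otimes> g) t \<cdot> v\<close>, since in \<open>X\<close> the outer factors \<open>u\<close> and \<open>v\<close>
  can be pulled out by associativity. Taking for \<open>L\<close> and \<open>R\<close> multiplications or identities covers the
  twisted product and both inclusions.\<close>

lemma mult_lift_tensor_map:
  assumes M: "module K M" and N: "module K N" and X: "unital_algebra K X"
    and f: "f \<in> linear_maps K M X" and g: "g \<in> linear_maps K N X"
    and L: "L \<in> linear_maps K M M" and R: "R \<in> linear_maps K N N"
    and u: "u \<in> carrier X" and v: "v \<in> carrier X"
    and fL: "\<And>x. x \<in> carrier M \<Longrightarrow> f (L x) = u \<otimes>\<^bsub>X\<^esub> f x"
    and gR: "\<And>y. y \<in> carrier N \<Longrightarrow> g (R y) = g y \<otimes>\<^bsub>X\<^esub> v"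
    and t: "t \<in> carrier (M \<boxtimes>\<^bsub>K\<^esub> N)"
  shows "mult_lift K X f g (tensor_map K M N L R t) = u \<otimes>\<^bsub>X\<^esub> mult_lift K X f g t \<otimes>\<^bsub>X\<^esub> v"
proof -
  interpret X: unital_algebra K X by fact
  note lift = mult_lift_linear[OF M N X f g] and map = tensor_map_linear[OF M N M N L R]
  show ?thesis
    using M N t
  proof (induction rule: tensor_induct)
    case (pure x y)
    have "mult_lift K X f g (tensor_map K M N L R (pure_tensor K M N x y)) = f (L x) \<otimes>\<^bsub>X\<^esub> g (R y)"
      using pure by (simp add: tensor_map_pure[OF M N M N L R] mult_lift_pure[OF M N X f g]
          linear_maps_closed[OF L] linear_maps_closed[OF R])
    also have "\<dots> = u \<otimes>\<^bsub>X\<^esub> mult_lift K X f g (pure_tensor K M N x y) \<otimes>\<^bsub>X\<^esub> v"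
      using pure u v linear_maps_closed[OF f] linear_maps_closed[OF g]
      by (simp add: fL gR mult_lift_pure[OF M N X f g] X.m_assoc)
    finally show ?case .
  next
    case (add s t)
    then show ?case
      using u v by (simp add: linear_maps_add[OF map] linear_maps_add[OF lift]
          linear_maps_closed[OF map] linear_maps_closed[OF lift] X.r_distr X.l_distr)
  qed
qed

text \<open>On pure tensors both sides equal \<open>f(a) g(b) f(a') g(b')\<close>: the left side is
  \<open>f(a) \<cdot> m (f \<otimes> g) (\<psi> (b \<otimes> a')) \<cdot> g(b')\<close>, and the exchange rule \<open>twist\<close> turns its middle
  factor into \<open>g(b) f(a')\<close>.\<close>

lemma mult_lift_twisted_mult:
  assumes A: "unital_algebra K A" and B: "unital_algebra K B" and X: "unital_algebra K X"
    and \<psi>: "\<psi> \<in> linear_maps K (B \<boxtimes>\<^bsub>K\<^esub> A) (A \<boxtimes>\<^bsub>K\<^esub> B)"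
    and f: "f \<in> algebra_homs K A X" and g: "g \<in> algebra_homs K B X"
    and twist: "\<And>t. t \<in> carrier (B \<boxtimes>\<^bsub>K\<^esub> A) \<Longrightarrow> mult_lift K X f g (\<psi> t) = mult_lift K X g f t"
    and s: "s \<in> carrier (A \<boxtimes>\<^bsub>K\<^esub> B)" and t: "t \<in> carrier (A \<boxtimes>\<^bsub>K\<^esub> B)"
  shows "mult_lift K X f g
      (twisted_mult K A B \<psi> (pure_tensor K (A \<boxtimes>\<^bsub>K\<^esub> B) (A \<boxtimes>\<^bsub>K\<^esub> B) s t))
    = mult_lift K X f g s \<otimes>\<^bsub>X\<^esub> mult_lift K X f g t"
proof -
  interpret X: unital_algebra K X by fact
  note modA = unital_algebra_module[OF A] and modB = unital_algebra_module[OF B]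
  note T = tensor_module[OF modA modB]
  have fl: "f \<in> linear_maps K A X" and gl: "g \<in> linear_maps K B X"
    and fm: "\<And>x y. \<lbrakk>x \<in> carrier A; y \<in> carrier A\<rbrakk> \<Longrightarrow> f (x \<otimes>\<^bsub>A\<^esub> y) = f x \<otimes>\<^bsub>X\<^esub> f y"
    and gm: "\<And>x y. \<lbrakk>x \<in> carrier B; y \<in> carrier B\<rbrakk> \<Longrightarrow> g (x \<otimes>\<^bsub>B\<^esub> y) = g x \<otimes>\<^bsub>X\<^esub> g y"
    using f g by (auto simp: algebra_homs_def ring_hom_def)
  let ?w = "mult_lift K X f g"
  note w = mult_lift_linear[OF modA modB X fl gl]
  note [simp] = linear_maps_closed[OF fl] linear_maps_closed[OF gl] linear_maps_closed[OF w]
    linear_maps_add[OF w]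
  let ?m = "\<lambda>s t. twisted_mult K A B \<psi> (pure_tensor K (A \<boxtimes>\<^bsub>K\<^esub> B) (A \<boxtimes>\<^bsub>K\<^esub> B) s t)"
  note left = linear_maps_comp[OF linear_maps_comp[OF w twisted_mult_linear[OF A B \<psi>]]
      bilinear_maps_left[OF pure_tensor_bilinear[OF T T]], unfolded comp_def]
  note right = linear_maps_comp[OF linear_maps_comp[OF w twisted_mult_linear[OF A B \<psi>]]
      bilinear_maps_right[OF pure_tensor_bilinear[OF T T]], unfolded comp_def]
  have pure_pure: "?w (?m (pure_tensor K A B a b) (pure_tensor K A B a' b'))
      = ?w (pure_tensor K A B a b) \<otimes>\<^bsub>X\<^esub> ?w (pure_tensor K A B a' b')"
    if ab: "a \<in> carrier A" "b \<in> carrier B" and ab': "a' \<in> carrier A" "b' \<in> carrier B" for a b a' b'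
  proof -
    have p: "pure_tensor K B A b a' \<in> carrier (B \<boxtimes>\<^bsub>K\<^esub> A)"
      by (intro pure_tensor_closed modA modB ab ab')
    have "?w (?m (pure_tensor K A B a b) (pure_tensor K A B a' b'))
        = ?w (tensor_map K A B (\<lambda>x. a \<otimes>\<^bsub>A\<^esub> x) (\<lambda>y. y \<otimes>\<^bsub>B\<^esub> b') (\<psi> (pure_tensor K B A b a')))"
      by (simp add: twisted_mult_pure[OF A B \<psi> ab ab'])
    also have "\<dots> = f a \<otimes>\<^bsub>X\<^esub> ?w (\<psi> (pure_tensor K B A b a')) \<otimes>\<^bsub>X\<^esub> g b'"
      by (intro mult_lift_tensor_map[OF modA modB X fl gl] linear_maps_closed[OF \<psi> p]
          bilinear_maps_right[OF mult_bilinear] bilinear_maps_left[OF mult_bilinear] A B)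
        (simp_all add: ab ab' fm gm)
    also have "\<dots> = f a \<otimes>\<^bsub>X\<^esub> (g b \<otimes>\<^bsub>X\<^esub> f a') \<otimes>\<^bsub>X\<^esub> g b'"
      using ab ab' by (simp add: twist[OF p] mult_lift_pure[OF modB modA X gl fl])
    also have "\<dots> = ?w (pure_tensor K A B a b) \<otimes>\<^bsub>X\<^esub> ?w (pure_tensor K A B a' b')"
      using ab ab' by (simp add: mult_lift_pure[OF modA modB X fl gl] X.m_assoc)
    finally show ?thesis .
  qed
  have pure_any: "?w (?m (pure_tensor K A B a b) t) = ?w (pure_tensor K A B a b) \<otimes>\<^bsub>X\<^esub> ?w t"
    if ab: "a \<in> carrier A" "b \<in> carrier B" for a b
    using modA modB t
  proof (induction rule: tensor_induct)
    case (pure a' b')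
    with ab show ?case by (rule pure_pure)
  next
    case (add s t)
    have p: "pure_tensor K A B a b \<in> carrier (A \<boxtimes>\<^bsub>K\<^esub> B)" by (intro pure_tensor_closed modA modB ab)
    from add show ?case
      by (simp add: linear_maps_add[OF right[OF p]] p X.r_distr)
  qed
  show ?thesis
    using modA modB s
  proof (induction rule: tensor_induct)
    case (pure a b)
    then show ?case by (rule pure_any)
  next
    case (add s s')
    then show ?case
      using t by (simp add: linear_maps_add[OF left[OF t]] X.l_distr)
  qed
qed

theorem theorem6p12:
  fixes K :: "('k, 'r) ring_scheme"
    and A :: "('k, 'a, 'm) module_scheme"
    and B :: "('k, 'b, 'n) module_scheme"
    and X :: "('k, 'x, 'p) module_scheme"
    and \<psi> :: "('b \<times> 'a \<Rightarrow> 'k) set \<Rightarrow> ('a \<times> 'b \<Rightarrow> 'k) set"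
    and \<eta>\<psi> :: "'k \<Rightarrow> ('a \<times> 'b \<Rightarrow> 'k) set"
    and j\<^sub>A :: "'a \<Rightarrow> 'x" and j\<^sub>B :: "'b \<Rightarrow> 'x"
  assumes "field K"
    and "unital_algebra K A" and "unital_algebra K B"
    and "\<psi> \<in> linear_maps K (B \<boxtimes>\<^bsub>K\<^esub> A) (A \<boxtimes>\<^bsub>K\<^esub> B)"
    and "twist_associative K A B \<psi>"
    and "is_unit_map K (A \<boxtimes>\<^bsub>K\<^esub> B) (twisted_mult K A B \<psi>) \<eta>\<psi>"
    and "unital_algebra K X"
    and "j\<^sub>A \<in> algebra_homs K A X" and "j\<^sub>B \<in> algebra_homs K B X"
    and "\<And>t. t \<in> carrier (B \<boxtimes>\<^bsub>K\<^esub> A) \<Longrightarrow>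
           (mult_map K X \<circ> tensor_map K X X j\<^sub>B j\<^sub>A) t
           = (mult_map K X \<circ> tensor_map K X X j\<^sub>A j\<^sub>B \<circ> \<psi>) t"
    and "\<And>c. c \<in> carrier K \<Longrightarrow>
           (mult_map K X \<circ> tensor_map K X X j\<^sub>A j\<^sub>B \<circ> \<eta>\<psi>) c = unit_map X c"
  shows "\<exists>\<omega>\<in>algebra_homs K (twisted_product K A B \<psi> \<eta>\<psi>) X.
           (\<forall>a\<in>carrier A. j\<^sub>A a = \<omega> (twist_incl_left K A B \<eta>\<psi> a)) \<and>
           (\<forall>b\<in>carrier B. j\<^sub>B b = \<omega> (twist_incl_right K A B \<eta>\<psi> b))"
proof -
  note A = assms(2) and B = assms(3) and X = assms(7)
  interpret A: unital_algebra K A by fact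
  interpret B: unital_algebra K B by fact
  interpret X: unital_algebra K X by fact
  have jA: "j\<^sub>A \<in> linear_maps K A X" and jB: "j\<^sub>B \<in> linear_maps K B X"
    and jA_mult: "\<And>x y. \<lbrakk>x \<in> carrier A; y \<in> carrier A\<rbrakk> \<Longrightarrow> j\<^sub>A (x \<otimes>\<^bsub>A\<^esub> y) = j\<^sub>A x \<otimes>\<^bsub>X\<^esub> j\<^sub>A y"
    and jB_mult: "\<And>x y. \<lbrakk>x \<in> carrier B; y \<in> carrier B\<rbrakk> \<Longrightarrow> j\<^sub>B (x \<otimes>\<^bsub>B\<^esub> y) = j\<^sub>B x \<otimes>\<^bsub>X\<^esub> j\<^sub>B y"
    using assms(8,9) by (auto simp: algebra_homs_def ring_hom_def)
  note [simp] = linear_maps_closed[OF jA] linear_maps_closed[OF jB]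
  define \<omega> where "\<omega> = mult_lift K X j\<^sub>A j\<^sub>B"
  have lin: "\<omega> \<in> linear_maps K (A \<boxtimes>\<^bsub>K\<^esub> B) X"
    unfolding \<omega>_def by (intro mult_lift_linear unital_algebra_module A B X jA jB)
  have z: "\<eta>\<psi> \<one>\<^bsub>K\<^esub> \<in> carrier (A \<boxtimes>\<^bsub>K\<^esub> B)"
    using assms(6) by (auto simp: is_unit_map_def linear_maps_def self_module_def)
  have \<omega>_z: "\<omega> (\<eta>\<psi> \<one>\<^bsub>K\<^esub>) = \<one>\<^bsub>X\<^esub>"
    using assms(11)[of "\<one>\<^bsub>K\<^esub>"] by (simp add: \<omega>_def mult_lift_def unit_map_def)
  have twist: "mult_lift K X j\<^sub>A j\<^sub>B (\<psi> t) = mult_lift K X j\<^sub>B j\<^sub>A t"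
    if "t \<in> carrier (B \<boxtimes>\<^bsub>K\<^esub> A)" for t
    using assms(10)[OF that] by (simp add: mult_lift_def)
  note mult = mult_lift_twisted_mult[OF A B X assms(4,8,9) twist, folded \<omega>_def]
  note translate = mult_lift_tensor_map[OF A.module_axioms B.module_axioms X jA jB, folded \<omega>_def]
  show ?thesis
  proof (intro bexI conjI ballI)
    show "\<omega> \<in> algebra_homs K (twisted_product K A B \<psi> \<eta>\<psi>) X"
      using lin mult \<omega>_z
      by (auto simp: algebra_homs_def ring_hom_def twisted_product_def linear_maps_def)
  next
    fix a assume a: "a \<in> carrier A"
    have "\<omega> (tensor_map K A B (\<lambda>x. a \<otimes>\<^bsub>A\<^esub> x) id (\<eta>\<psi> \<one>\<^bsub>K\<^esub>)) = j\<^sub>A a \<otimes>\<^bsub>X\<^esub> \<omega> (\<eta>\<psi> \<one>\<^bsub>K\<^esub>) \<otimes>\<^bsub>X\<^esub> \<one>\<^bsub>X\<^esub>"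
      by (intro translate bilinear_maps_right[OF mult_bilinear] linear_maps_id A z)
        (simp_all add: a jA_mult)
    then show "j\<^sub>A a = \<omega> (twist_incl_left K A B \<eta>\<psi> a)"
      by (simp add: twist_incl_left_def \<omega>_z a)
  next
    fix b assume b: "b \<in> carrier B"
    have "\<omega> (tensor_map K A B id (\<lambda>y. y \<otimes>\<^bsub>B\<^esub> b) (\<eta>\<psi> \<one>\<^bsub>K\<^esub>)) = \<one>\<^bsub>X\<^esub> \<otimes>\<^bsub>X\<^esub> \<omega> (\<eta>\<psi> \<one>\<^bsub>K\<^esub>) \<otimes>\<^bsub>X\<^esub> j\<^sub>B b"
      by (intro translate bilinear_maps_left[OF mult_bilinear] linear_maps_id B z)
        (simp_all add: b jB_mult)
    then show "j\<^sub>B b = \<omega> (twist_incl_right K A B \<eta>\<psi> b)"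
      by (simp add: twist_incl_right_def \<omega>_z b)
  qed
qed

end
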